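(* Let $T:\mathbb T\to\mathbb T$, $T(x)=x(1+V(x)) \bmod 1$, be a map in the family $\mathscr F$. Let $\omega,\Omega\in\mathcal M$ be such that $\Omega$ is $T$-compatible with respect to $\omega$, and let $f\in\mathscr C_\omega(\mathbb T)$. Then there exist a Borel probability measure $\nu$ on $\mathbb T$ and a constant $\chi>0$ such that $$\mathscr L_f^*\nu=\chi\,\nu .$$ The number $\chi$ is a simple eigenvalue of the operator $\mathscr L_f$, and there is a positive function $h\in\mathscr C_\Omega(\mathbb T)$ such that $$\mathscr L_f h=\chi\,h .$$ The constant $\chi$ is a maximal eigenvalue in the sense that $\mathscr L_f$, acting on complex-valued continuous functions on $\mathbb T$, has no eigenvalue $c\neq\chi$ with $|c|\ge\chi$. Moreover, supposing that $h$ is normalized so that $\int h\,d\nu=1$, for every continuous function $\phi$ on $\mathbb T$ the sequence $\{\chi^{-n}\mathscr L_f^n\phi\}_{n\ge1}$ converges uniformly on $\mathbb T$ to $h\int\phi\,d\nu$ as $n\to\infty$.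
   Context: $\mathbb T=\mathbb R/\mathbb Z=[0,1)$ is the circle with metric $d(x,y)=\min\{|x-y|,|x-y\pm1|\}$. Family $\mathscr F$: all continuous maps $T:\mathbb T\to\mathbb T$ of the form $T(x)=x(1+V(x))\bmod 1$ for $x\in[0,1)$, where $V:[0,+\infty)\to[0,+\infty)$ is continuous and increasing, $V(0)=0$ (so $0$ is an indifferent fixed point), $V(1)$ is a positive integer, and for some $\sigma\ge0$ one has $\lim_{x\to0}V(tx)/V(x)=t^\sigma$ for all $t>0$. $\mathcal M$ is the set of all concave moduli of continuity, i.e. concave, continuous, non-decreasing functions $\omega:[0,+\infty)\to[0,+\infty)$ with $\omega(0)=0$. For $\omega\in\mathcal M$, $\mathscr C_\omega(\mathbb T)$ is the linear space of functions $\varphi:\mathbb T\to\mathbb R$ for which there is $C>0$ with $|\varphi(x)-\varphi(y)|\le C\,\omega(d(x,y))$ for all $x,y\in\mathbb T$. $T$-compatibility: for $T\in\mathscr F$ and $\omega,\Omega\in\mathcal M$, $\Omega$ is $T$-compatible with respect to $\omega$ if there are constants $\varrho_1>0$ and $C_1>0$ such that, given any sequence $\{x_k\}_{k\ge0}$ in $\mathbb T$ with $T(x_{k+1})=x_k$ for $k\ge0$, and a point $y_0\in\mathbb T$ with $d(x_0,y_0)<\varrho_1$, there is a unique pre-orbit $\{y_k\}_{k\ge1}$ of $y_0$ (that is, $T(y_{k+1})=y_k$ for $k\ge0$) satisfying, for all $k\ge1$, $$d(x_k,y_k)\le d(x_0,y_0)<\varrho_1\quad\text{and}\quad \Omega(d(x_k,y_k))+C_1\sum_{j=1}^k\omega(d(x_j,y_j))\le\Omega(d(x_0,y_0));$$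 moreover, this correspondence between pre-orbits of $x_0$ and pre-orbits of $y_0$ is one-to-one. Transfer operator: for continuous $f:\mathbb T\to\mathbb R$, $\mathscr L_f\phi(x)=\sum_{y\in T^{-1}(x)}e^{f(y)}\phi(y)$ for $\phi\in C^0(\mathbb T)$ (continuous functions with the uniform norm). The dual $\mathscr L_f^*$ acts on finite signed Borel measures by $\int\phi\,d(\mathscr L_f^*m)=\int\mathscr L_f\phi\,dm$ for all $\phi\in C^0(\mathbb T)$. *)

theory Defs
  imports "HOL-Probability.Probability"
begin

(* The circle R/Z, represented by the fundamental domain [0,1).  The topology, and hence
   continuity and the Borel sets, comes from the metric below, not from the subspace
   topology of [0,1). *)

typedef circle = "{0..<1::real}"
  morphisms coord Circle
  by (rule exI[of _ 0]) simp

instantiation circle :: metric_space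
begin

definition dist_circle :: "circle \<Rightarrow> circle \<Rightarrow> real" where
  "dist x y = Min {\<bar>coord x - coord y\<bar>, \<bar>coord x - coord y + 1\<bar>, \<bar>coord x - coord y - 1\<bar>}"

definition uniformity_circle :: "(circle \<times> circle) filter" where
  "uniformity = (INF e\<in>{0<..}. principal {(x::circle, y). dist x y < e})"

definition open_circle :: "circle set \<Rightarrow> bool" where
  "open (U :: circle set) \<longleftrightarrow> (\<forall>x\<in>U. eventually (\<lambda>(x', y). x' = x \<longrightarrow> y \<in> U) uniformity)"

instance
proof
  fix x y z :: circle
  note bounds = coord[of x] coord[of y] coord[of z]
  have "coord x = coord y" if "dist x y = 0"
    using that bounds unfolding dist_circle_def by (auto simp: min_def split: if_splits)
  then show "dist x y = 0 \<longleftrightarrow> x = y"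
    by (auto simp: coord_inject) (simp add: dist_circle_def)
  show "dist x y \<le> dist x z + dist y z"
    using bounds unfolding dist_circle_def by (auto simp: min_def abs_if)
qed (simp_all add: uniformity_circle_def open_circle_def)

end

definition family_F :: "(circle \<Rightarrow> circle) set" where
  "family_F = {T. continuous_on UNIV T \<and>
     (\<exists>V :: real \<Rightarrow> real.
        (\<forall>x. coord (T x) = frac (coord x * (1 + V (coord x)))) \<and>
        V ` {0..} \<subseteq> {0..} \<and> continuous_on {0..} V \<and> mono_on {0..} V \<and> V 0 = 0 \<and>
        (\<exists>n::nat. n > 0 \<and> V 1 = real n) \<and>
        (\<exists>\<sigma>\<ge>0. \<forall>t>0. ((\<lambda>x. V (t * x) / V x) \<longlongrightarrow> t powr \<sigma>) (at_right 0)))}"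

definition moduli :: "(real \<Rightarrow> real) set" where
  "moduli = {\<omega>. \<omega> ` {0..} \<subseteq> {0..} \<and> concave_on {0..} \<omega> \<and> continuous_on {0..} \<omega> \<and>
     mono_on {0..} \<omega> \<and> \<omega> 0 = 0}"

definition C_mod :: "(real \<Rightarrow> real) \<Rightarrow> (circle \<Rightarrow> real) set" where
  "C_mod \<omega> = {\<phi>. \<exists>C>0. \<forall>x y. \<bar>\<phi> x - \<phi> y\<bar> \<le> C * \<omega> (dist x y)}"

(* A pre-orbit is a sequence indexed from 0, its 0-th term being the base point. *)
definition preorbits :: "(circle \<Rightarrow> circle) \<Rightarrow> circle \<Rightarrow> (nat \<Rightarrow> circle) set" where
  "preorbits T p = {x. x 0 = p \<and> (\<forall>k. T (x (Suc k)) = x k)}"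

definition tracks ::
  "(real \<Rightarrow> real) \<Rightarrow> (real \<Rightarrow> real) \<Rightarrow> real \<Rightarrow> (nat \<Rightarrow> circle) \<Rightarrow> (nat \<Rightarrow> circle) \<Rightarrow> bool" where
  "tracks \<omega> \<Omega> C x y \<longleftrightarrow>
     (\<forall>k\<ge>1. dist (x k) (y k) \<le> dist (x 0) (y 0) \<and>
        \<Omega> (dist (x k) (y k)) + C * (\<Sum>j=1..k. \<omega> (dist (x j) (y j))) \<le> \<Omega> (dist (x 0) (y 0)))"

definition compatible ::
  "(circle \<Rightarrow> circle) \<Rightarrow> (real \<Rightarrow> real) \<Rightarrow> (real \<Rightarrow> real) \<Rightarrow> bool" where
  "compatible T \<omega> \<Omega> \<longleftrightarrow>
     (\<exists>\<rho>>0. \<exists>C>0. \<forall>p q. dist p q < \<rho> \<longrightarrow>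
        (\<forall>x\<in>preorbits T p. \<exists>!y. y \<in> preorbits T q \<and> tracks \<omega> \<Omega> C x y) \<and>
        bij_betw (\<lambda>x. THE y. y \<in> preorbits T q \<and> tracks \<omega> \<Omega> C x y)
          (preorbits T p) (preorbits T q))"

(* Polymorphic in the codomain, so that the same operator acts on real-valued and on
   complex-valued functions. *)
definition transfer_op ::
  "(circle \<Rightarrow> circle) \<Rightarrow> (circle \<Rightarrow> real) \<Rightarrow> (circle \<Rightarrow> 'a) \<Rightarrow> circle \<Rightarrow> 'a::real_vector" where
  "transfer_op T f \<phi> x = (\<Sum>y\<in>T -` {x}. exp (f y) *\<^sub>R \<phi> y)"

(* The sums above range over finite sets, so they never take the default value 0. *)
lemma finite_fibre:
  assumes "T \<in> family_F"
  shows "finite (T -` {x})"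
proof -
  obtain V n where T: "\<And>x. coord (T x) = frac (coord x * (1 + V (coord x)))"
    and V: "V ` {0..} \<subseteq> {0..}" "mono_on {0..} V" "V 1 = real n"
    using assms by (auto simp: family_F_def)
  define g where "g y = coord y * (1 + V (coord y))" for y
  have c: "0 \<le> coord y" "coord y < 1" for y
    using coord[of y] by auto
  have V_ge: "0 \<le> V (coord y)" for y
    using V(1) c by force
  have "g y < g z" if "coord y < coord z" for y z
    unfolding g_def
    by (rule mult_less_le_imp_less)
      (use that c V_ge mono_onD[OF V(2), of "coord y" "coord z"] in \<open>auto simp: add_pos_nonneg\<close>)
  then have inj: "inj g"
    by (metis coord_inject injI less_irrefl linorder_neqE)
  have g_le: "0 \<le> g y \<and> g y \<le> 1 + real n" for y
  proof -
    have "g y \<le> 1 * (1 + V 1)"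
      unfolding g_def
      by (rule mult_mono) (use c[of y] V_ge[of y] mono_onD[OF V(2), of "coord y" 1] in auto)
    then show ?thesis using c V_ge V(3) by (simp add: g_def)
  qed
  have "g ` (T -` {x}) \<subseteq> (\<lambda>k. coord x + of_int k) ` {0..int n + 1}"
  proof
    fix u assume "u \<in> g ` (T -` {x})"
    then obtain y where y: "u = g y" "T y = x" by auto
    have "u = coord x + of_int \<lfloor>u\<rfloor>"
      using T[of y] y by (simp add: g_def frac_def)
    moreover have "\<lfloor>u\<rfloor> \<in> {0..int n + 1}"
      using g_le[of y] y(1) by (auto simp: floor_le_iff)
    ultimately show "u \<in> (\<lambda>k. coord x + of_int k) ` {0..int n + 1}" by blast
  qed
  then have "finite (g ` (T -` {x}))"
    by (rule finite_subset) simp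
  then show ?thesis
    using inj by (meson finite_imageD inj_on_subset subset_UNIV)
qed

(* transfer_dual T f m m' says that the dual operator maps m to m'; a finite Borel measure
   on the circle is determined by its integrals of continuous functions.  Only positive
   measures are considered. *)
definition transfer_dual ::
  "(circle \<Rightarrow> circle) \<Rightarrow> (circle \<Rightarrow> real) \<Rightarrow> circle measure \<Rightarrow> circle measure \<Rightarrow> bool" where
  "transfer_dual T f m m' \<longleftrightarrow>
     finite_measure m \<and> sets m = sets borel \<and> finite_measure m' \<and> sets m' = sets borel \<and>
     (\<forall>\<phi> :: circle \<Rightarrow> real. continuous_on UNIV \<phi> \<longrightarrow>
        (\<integral>x. \<phi> x \<partial>m') = (\<integral>x. transfer_op T f \<phi> x \<partial>m))"

(* Eigenvalues are those of an operator on the space of continuous functions. *)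
definition eigenvalue ::
  "((circle \<Rightarrow> 'a) \<Rightarrow> circle \<Rightarrow> 'a) \<Rightarrow> 'a::real_normed_field \<Rightarrow> bool" where
  "eigenvalue L c \<longleftrightarrow>
     (\<exists>\<phi>. continuous_on UNIV \<phi> \<and> \<phi> \<noteq> (\<lambda>_. 0) \<and> L \<phi> = (\<lambda>x. c * \<phi> x))"

(* Algebraic simplicity: the generalized eigenspace, and therefore also the eigenspace,
   is one-dimensional. *)
definition simple_eigenvalue ::
  "((circle \<Rightarrow> 'a) \<Rightarrow> circle \<Rightarrow> 'a) \<Rightarrow> 'a::real_normed_field \<Rightarrow> bool" where
  "simple_eigenvalue L c \<longleftrightarrow> eigenvalue L c \<and>
     (\<exists>\<phi>. {\<psi>. continuous_on UNIV \<psi> \<and> (\<exists>n. ((\<lambda>g x. L g x - c * g x) ^^ n) \<psi> = (\<lambda>_. 0))}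
        = range (\<lambda>a x. a * \<phi> x))"

end

theory Submission imports Defs begin

text \<open>
  Write \<open>L\<close> for the transfer operator and \<open>r\<^sub>n \<phi> = L\<^sup>n \<phi> / L\<^sup>n 1\<close>. Everything follows from one fact:
  for continuous \<open>\<phi>\<close> the functions \<open>r\<^sub>n \<phi>\<close> converge uniformly to a constant. For positive \<open>\<phi>\<close> the
  speed depends only on an upper bound of \<open>\<phi>\<close> and on a modulus of continuity of \<open>log \<phi>\<close>.

  Compatibility supplies the distortion control. Nearby points \<open>p\<close>, \<open>q\<close> have their preimages
  paired by a bijection \<open>\<pi>\<close> such that \<open>d(z, \<pi> z) \<le> d(p,q)\<close> and, for a constant \<open>K\<close>, the loss
  \<open>f z - f (\<pi> z)\<close> is at most \<open>K \<Omega>(d(p,q)) - K \<Omega>(d(z, \<pi> z))\<close>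
  (\<open>compatible_branches\<close>). Summing over preimages, an estimate
  \<open>\<phi>(p) \<le> \<phi>(q) exp(K \<Omega>(d(p,q)) + \<epsilon>)\<close> for close \<open>p\<close>, \<open>q\<close> is inherited by \<open>L \<phi>\<close> with the same
  constants (\<open>L_log_cont\<close>). Every positive continuous function satisfies such estimates for
  all \<open>\<epsilon> > 0\<close>, so its ratios \<open>r\<^sub>n \<phi>\<close> are equicontinuous.

  Mixing supplies the contraction. Some power \<open>T\<^sup>N\<close> maps every \<open>\<delta>\<close>-ball onto the circle
  (\<open>family_F_mixing\<close>), and \<open>r\<^bsub>N+n\<^esub> \<phi>(x)\<close> is an average of the values of \<open>r\<^sub>n \<phi>\<close> on the preimages
  of \<open>x\<close> under \<open>T\<^sup>N\<close>, with weights bounded below. One of these preimages is close to a point where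
  \<open>r\<^sub>n \<phi>\<close> is small, which pulls the maximum down by a fixed proportion of the oscillation
  (\<open>ratio_improve\<close>, \<open>ratio_contract\<close>).

  The limit of \<open>r\<^sub>n \<phi>\<close> is the integral of \<open>\<phi>\<close> against a probability measure \<open>\<nu>\<close>
  (\<open>ratio_limit_measure\<close>), and \<open>r\<^sub>k (L \<phi>) = r\<^bsub>k+1\<^esub> \<phi> \<cdot> r\<^sub>k (L 1)\<close> shows that \<open>\<nu>\<close> is an
  eigenmeasure with eigenvalue \<open>\<chi> = \<integral> L 1 d\<nu>\<close> (\<open>integral_L\<close>). The functions \<open>\<chi>\<^sup>-\<^sup>m L\<^sup>m 1\<close> have integral
  1 and share bounds and a modulus, so the common speed of contraction makes them a
  uniform Cauchy sequence (\<open>norm_iter_Cauchy\<close>). Their limit is the eigenfunction \<open>h\<close>, and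
  \<open>\<chi>\<^sup>-\<^sup>n L\<^sup>n \<phi> = r\<^sub>n \<phi> \<cdot> \<chi>\<^sup>-\<^sup>n L\<^sup>n 1\<close> converges to \<open>h \<integral> \<phi> d\<nu>\<close>. The spectral
  statements are formal consequences of this convergence.
\<close>

section \<open>The circle as a quotient of the line\<close>

definition proj :: "real \<Rightarrow> circle" where
  "proj t = Circle (frac t)"

lemma coord_bounds: "0 \<le> coord p" "coord p < 1"
  using coord[of p] by auto

lemma coord_proj [simp]: "coord (proj t) = frac t"
  by (simp add: proj_def Circle_inverse frac_lt_1)

lemma frac_coord [simp]: "frac (coord p) = coord p"
  using coord_bounds[of p] by (simp add: frac_eq)

lemma proj_coord [simp]: "proj (coord p) = p"
  by (simp add: proj_def coord_inverse)

lemma proj_add_int [simp]: "proj (t + of_int k) = proj t"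
  by (simp add: proj_def frac_def)

lemma dist_proj_le: "dist (proj a) (proj b) \<le> \<bar>a - b\<bar>"
proof -
  define k where "k = \<lfloor>a\<rfloor> - \<lfloor>b\<rfloor>"
  have d: "frac a - frac b = (a - b) - of_int k"
    by (simp add: frac_def k_def)
  have fr: "0 \<le> frac a" "frac a < 1" "0 \<le> frac b" "frac b < 1"
    by (auto simp: frac_lt_1)
  have m: "dist (proj a) (proj b) \<le> \<bar>frac a - frac b\<bar>"
    "dist (proj a) (proj b) \<le> \<bar>frac a - frac b + 1\<bar>"
    "dist (proj a) (proj b) \<le> \<bar>frac a - frac b - 1\<bar>"
    by (simp_all add: dist_circle_def)
  have "k = 0 \<or> k = 1 \<or> k = -1 \<or> of_int k \<ge> (2::real) \<or> of_int k \<le> (-2::real)"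
    by linarith
  then show ?thesis
    using d fr m by (elim disjE; linarith)
qed

lemma dist_le_one: "dist (p::circle) q \<le> 1"
  using dist_proj_le[of "coord p" "coord q"] coord_bounds[of p] coord_bounds[of q] by auto

lemma exists_lift_dist:
  obtains a b where "proj a = p" "proj b = q" "\<bar>a - b\<bar> = dist p q"
proof -
  consider "dist p q = \<bar>coord p - coord q\<bar>" | "dist p q = \<bar>coord p - coord q + 1\<bar>"
    | "dist p q = \<bar>coord p - coord q - 1\<bar>"
    using Min_in[of "{\<bar>coord p - coord q\<bar>, \<bar>coord p - coord q + 1\<bar>, \<bar>coord p - coord q - 1\<bar>}"]
    unfolding dist_circle_def by blast
  then show thesis
  proof cases
    case 1 then show ?thesis using that[of "coord p" "coord q"] by simp
  next
    case 2 then show ?thesis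
      using that[of "coord p + of_int 1" "coord q"] proj_add_int[of "coord p" 1] by (simp add: algebra_simps)
  next
    case 3 then show ?thesis
      using that[of "coord p + of_int (-1)" "coord q"] proj_add_int[of "coord p" "-1"] by (simp add: algebra_simps)
  qed
qed

lemma continuous_on_proj: "continuous_on UNIV proj"
  unfolding continuous_on_iff
  by (metis dist_proj_le dist_real_def le_less_trans)

lemma compact_circle: "compact (UNIV :: circle set)"
proof -
  have "proj ` {0..1} = UNIV"
  proof (intro equalityI subsetI UNIV_I)
    fix p show "p \<in> proj ` {0..1}"
      using coord_bounds[of p] by (intro image_eqI[of _ _ "coord p"]) auto
  qed
  moreover have "compact (proj ` {0..1})"
    by (intro compact_continuous_image continuous_on_subset[OF continuous_on_proj]) auto
  ultimately show ?thesis by simp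
qed

text \<open>The circle is a length space: a shortest arc from \<^term>\<open>p\<close> to \<^term>\<open>q\<close> can be cut into
  \<^term>\<open>N\<close> pieces that are all short, so local multiplicative control becomes global.\<close>

lemma global_from_local_log_bound:
  fixes u :: "circle \<Rightarrow> real"
  assumes "\<rho> > 0" and mono: "mono_on {0..} \<theta>" and u: "\<And>p. 0 \<le> u p"
    and loc: "\<And>p q. dist p q < \<rho> \<Longrightarrow> u p \<le> u q * exp (\<theta> (dist p q))"
    and N: "1 / \<rho> < real N"
  shows "u p \<le> u q * exp (real N * \<theta> (dist p q))"
proof -
  obtain a b where ab: "proj a = p" "proj b = q" "\<bar>a - b\<bar> = dist p q"
    by (rule exists_lift_dist)
  have N0: "0 < real N" using N \<open>\<rho> > 0\<close> by (meson divide_pos_pos less_trans zero_less_one)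
  define c where "c i = proj (a + (b - a) * (real i / real N))" for i :: nat
  have step: "dist (c i) (c (Suc i)) \<le> dist p q / real N" for i
  proof -
    have "(a + (b - a) * (real i / real N)) - (a + (b - a) * (real (Suc i) / real N)) = (a - b) / real N"
      using N0 by (simp add: field_simps)
    then show ?thesis
      using dist_proj_le[of "a + (b - a) * (real i / real N)" "a + (b - a) * (real (Suc i) / real N)"]
        ab N0 by (simp add: c_def)
  qed
  have small: "dist (c i) (c (Suc i)) < \<rho>" for i
  proof -
    have "dist p q / real N \<le> 1 / real N" using dist_le_one N0 by (simp add: divide_right_mono)
    also have "\<dots> < \<rho>" using N N0 \<open>\<rho> > 0\<close> by (simp add: field_simps)
    finally show ?thesis using step[of i] by linarith
  qed
  have le: "dist (c i) (c (Suc i)) \<le> dist p q" for i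
  proof -
    have "dist p q / real N \<le> dist p q / 1" using N0 by (intro divide_left_mono) auto
    then show ?thesis using step[of i] by linarith
  qed
  have "u (c 0) \<le> u (c i) * exp (real i * \<theta> (dist p q))" for i
  proof (induction i)
    case (Suc i)
    have "u (c i) \<le> u (c (Suc i)) * exp (\<theta> (dist (c i) (c (Suc i))))"
      by (rule loc[OF small])
    also have "\<dots> \<le> u (c (Suc i)) * exp (\<theta> (dist p q))"
      using mono_onD[OF mono _ _ le[of i]] u by (simp add: mult_left_mono)
    finally have "u (c i) * exp (real i * \<theta> (dist p q))
        \<le> u (c (Suc i)) * exp (\<theta> (dist p q)) * exp (real i * \<theta> (dist p q))"
      by (simp add: mult_right_mono)
    also have "\<dots> = u (c (Suc i)) * exp (real (Suc i) * \<theta> (dist p q))"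
      by (simp add: exp_add[symmetric] algebra_simps)
    finally show ?case using Suc by linarith
  qed simp
  from this[of N] show ?thesis using ab N0 by (simp add: c_def)
qed

section \<open>Mixing of the maps in the family\<close>

text \<open>The map \<open>x \<mapsto> x (1 + V x)\<close> extends to a lift \<^term>\<open>F\<close> with \<open>F (t + 1) = F t + n + 1\<close>. Its
  displacement \<open>E t = F t - t\<close> is monotone and, because \<^term>\<open>V\<close> is positive off the fixed point,
  increases by a definite amount along every interval of a given length, including those that start
  at the fixed point.\<close>

lemma family_F_lift:
  assumes "T \<in> family_F"
  obtains F :: "real \<Rightarrow> real" where
    "\<And>t. proj (F t) = T (proj t)" "surj F"
    "\<And>l. 0 < l \<Longrightarrow> l \<le> 1 \<Longrightarrow> \<exists>\<eta>>0. \<forall>s t. l \<le> t - s \<longrightarrow> F t - F s \<ge> (t - s) + \<eta>"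
proof -
  obtain V n \<sigma> where T: "\<And>x. coord (T x) = frac (coord x * (1 + V (coord x)))"
    and V: "V ` {0..} \<subseteq> {0..}" "continuous_on {0..} V" "mono_on {0..} V" "V 0 = 0"
    and n: "n > 0" "V 1 = real n"
    and \<sigma>: "\<And>t. t > 0 \<Longrightarrow> ((\<lambda>x. V (t * x) / V x) \<longlongrightarrow> t powr \<sigma>) (at_right 0)"
    using assms unfolding family_F_def by blast
  have V0: "0 \<le> V x" if "0 \<le> x" for x using V(1) that by auto
  have Vm: "V x \<le> V y" if "0 \<le> x" "x \<le> y" for x y
    using mono_onD[OF V(3)] that by auto
  \<comment> \<open>If \<^term>\<open>V\<close> vanished near 0, the quotient in the regularity condition would vanish there too,
     while its limit is 1 for \<open>t = 1\<close>.\<close>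
  have Vpos: "0 < V x" if "0 < x" for x
  proof (rule ccontr)
    assume "\<not> 0 < V x"
    then have z: "V y = 0" if "0 \<le> y" "y \<le> x" for y
      using Vm[of y x] V0[of y] that by linarith
    have "eventually (\<lambda>y. V (1 * y) / V y = 0) (at_right 0)"
      using eventually_at_right_less[of 0] eventually_at_right_real[OF \<open>0 < x\<close>]
      by eventually_elim (simp add: z)
    then have "((\<lambda>y. V (1 * y) / V y) \<longlongrightarrow> 0) (at_right 0)"
      by (rule tendsto_eventually)
    with \<sigma>[of 1] have "(1::real) powr \<sigma> = 0"
      by (intro tendsto_unique[of "at_right (0::real)"]) auto
    then show False by simp
  qed
  define E where "E t = frac t * V (frac t) + real n * of_int \<lfloor>t\<rfloor>" for t
  define F where "F t = t + E t" for t
  have E_piece: "E t = (t - of_int k) * V (t - of_int k) + real n * of_int k"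
    if "of_int k \<le> t" "t \<le> of_int k + 1" for t k
  proof (cases "t = of_int k + 1")
    case True
    then have "\<lfloor>t\<rfloor> = k + 1" by simp
    then show ?thesis using True n by (simp add: E_def frac_def algebra_simps)
  next
    case False
    then have "\<lfloor>t\<rfloor> = k" using that by (simp add: floor_unique)
    then show ?thesis by (simp add: E_def frac_def)
  qed
  have growth_piece: "(t - s) * V (t - s) \<le> E t - E s"
    if "of_int k \<le> s" "s \<le> t" "t \<le> of_int k + 1" for s t k
  proof -
    have "(s - of_int k) * V (s - of_int k) \<le> (s - of_int k) * V (t - of_int k)"
      using that by (intro mult_left_mono Vm) auto
    moreover have "(t - s) * V (t - s) \<le> (t - s) * V (t - of_int k)"
      using that by (intro mult_left_mono Vm) auto
    ultimately show ?thesis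
      using that E_piece[of k s] E_piece[of k t] by (simp add: algebra_simps)
  qed
  have E_mono: "E s \<le> E t" if "s \<le> t" for s t
  proof (cases "t \<le> of_int \<lfloor>s\<rfloor> + 1")
    case True
    have "0 \<le> (t - s) * V (t - s)" using that V0 by simp
    also have "\<dots> \<le> E t - E s"
      using True that by (intro growth_piece[of "\<lfloor>s\<rfloor>"]) auto
    finally show ?thesis by simp
  next
    case False
    let ?k = "\<lfloor>s\<rfloor>"
    have "0 \<le> (of_int ?k + 1 - s) * V (of_int ?k + 1 - s)"
      using V0[of "of_int ?k + 1 - s"] real_of_int_floor_add_one_ge[of s] by simp
    also have "\<dots> \<le> E (of_int ?k + 1) - E s"
      using real_of_int_floor_add_one_ge[of s] by (intro growth_piece[of ?k]) auto
    finally have 1: "E s \<le> E (of_int ?k + 1)" by simp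
    have 2: "E (of_int ?k + 1) = real n * of_int (?k + 1)"
      using E_piece[of "?k + 1" "of_int ?k + 1"] V(4) by simp
    have "?k + 1 \<le> \<lfloor>t\<rfloor>" using False by linarith
    then have 3: "real n * of_int (?k + 1) \<le> real n * of_int \<lfloor>t\<rfloor>"
      by (intro mult_left_mono) (auto simp only: of_int_le_iff)
    have "0 \<le> frac t * V (frac t)" using V0[of "frac t"] by simp
    then have "real n * of_int \<lfloor>t\<rfloor> \<le> E t" by (simp add: E_def)
    then show ?thesis using 1 2 3 by linarith
  qed
  \<comment> \<open>One half of an interval of length at most 1 has no integer in its interior.\<close>
  have growth: "(l / 2) * V (l / 2) \<le> E (s + l) - E s" if "0 < l" "l \<le> 1" for s l
  proof (cases "s + l / 2 \<le> of_int \<lfloor>s\<rfloor> + 1")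
    case True
    have "(l / 2) * V (l / 2) \<le> E (s + l / 2) - E s"
      using growth_piece[of "\<lfloor>s\<rfloor>" s "s + l / 2"] True that by auto
    moreover have "E (s + l / 2) \<le> E (s + l)" using that by (intro E_mono) auto
    ultimately show ?thesis by linarith
  next
    case False
    have "s + l \<le> of_int (\<lfloor>s\<rfloor> + 1) + 1" using that by linarith
    then have "(l / 2) * V (l / 2) \<le> E (s + l) - E (s + l / 2)"
      using growth_piece[of "\<lfloor>s\<rfloor> + 1" "s + l / 2" "s + l"] False that by auto
    moreover have "E s \<le> E (s + l / 2)" using that by (intro E_mono) auto
    ultimately show ?thesis by linarith
  qed
  show thesis
  proof (rule that[of F])
    show "proj (F t) = T (proj t)" for t
    proof -
      have "F t = frac t * (1 + V (frac t)) + of_int ((1 + int n) * \<lfloor>t\<rfloor>)"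
        by (simp add: F_def E_def frac_def algebra_simps)
      then have "proj (F t) = proj (frac t * (1 + V (frac t)))"
        by (simp only: proj_add_int)
      also have "\<dots> = T (proj t)"
        by (metis T coord_proj coord_inverse proj_def)
      finally show ?thesis .
    qed
    have "\<exists>t. F t = y" for y
    proof -
      define k where "k = \<lfloor>y / (1 + real n)\<rfloor>"
      have "of_int k \<le> y / (1 + real n)" "y / (1 + real n) < of_int k + 1"
        unfolding k_def by linarith+
      then have "of_int k * (1 + real n) \<le> y" "y \<le> (of_int k + 1) * (1 + real n)"
        by (simp_all add: field_simps)
      moreover have "continuous_on {0..1} (\<lambda>t. t * (1 + V t))"
        by (intro continuous_intros continuous_on_subset[OF V(2)]) auto
      ultimately obtain t where t: "0 \<le> t" "t \<le> 1"
        "t * (1 + V t) = y - of_int k * (1 + real n)"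
        using IVT'[of "\<lambda>t. t * (1 + V t)" 0 "y - of_int k * (1 + real n)" 1] n
        by (auto simp: algebra_simps)
      have "F (of_int k + t) = y"
        using t E_piece[of k "of_int k + t"] by (simp add: F_def algebra_simps)
      then show ?thesis by blast
    qed
    then show "surj F" by (metis surjI)
    show "\<exists>\<eta>>0. \<forall>s t. l \<le> t - s \<longrightarrow> (t - s) + \<eta> \<le> F t - F s" if l: "0 < l" "l \<le> 1" for l
    proof (intro exI[of _ "(l / 2) * V (l / 2)"] conjI allI impI)
      show "0 < l / 2 * V (l / 2)" using l Vpos by simp
      fix s t :: real assume st: "l \<le> t - s"
      have "E (s + l) \<le> E t" using st by (intro E_mono) auto
      then show "(t - s) + l / 2 * V (l / 2) \<le> F t - F s"
        using growth[OF l, of s] by (simp add: F_def)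
    qed
  qed
qed

lemma family_F_surj:
  assumes "T \<in> family_F"
  shows "surj T"
proof -
  obtain F where F: "\<And>t. proj (F t) = T (proj t)" "surj F"
    using family_F_lift[OF assms] by metis
  have "x \<in> range T" for x
    by (metis F proj_coord rangeI surj_def)
  then show ?thesis by auto
qed

text \<open>Although the map is not uniformly expanding near its indifferent fixed point, the lift
  lengthens every interval of length at least \<^term>\<open>l\<close> by an amount that depends on \<^term>\<open>l\<close> only.
  Hence an arc of radius \<^term>\<open>\<delta>\<close> covers the circle after a time that does not depend on its
  position.\<close>

lemma family_F_mixing:
  assumes "T \<in> family_F" and "0 < \<delta>"
  shows "\<exists>N. \<forall>x z. \<exists>y. dist y z < \<delta> \<and> (T ^^ N) y = x"
proof -
  obtain F :: "real \<Rightarrow> real" where F: "\<And>t. proj (F t) = T (proj t)" "surj F"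
    "\<And>l. 0 < l \<Longrightarrow> l \<le> 1 \<Longrightarrow> \<exists>\<eta>>0. \<forall>s t. l \<le> t - s \<longrightarrow> F t - F s \<ge> (t - s) + \<eta>"
    using family_F_lift[OF assms(1)] by metis
  define l where "l = min (\<delta> / 2) 1"
  have l: "0 < l" "l \<le> 1" "l < \<delta>" using assms(2) by (auto simp: l_def)
  obtain \<eta> where \<eta>: "\<eta> > 0" "\<And>s t. l \<le> t - s \<Longrightarrow> F t - F s \<ge> (t - s) + \<eta>"
    using F(3)[OF l(1,2)] by blast
  have F_less: "F s < F t" if "s < t" for s t
  proof -
    have "0 < min (t - s) 1" "min (t - s) 1 \<le> 1" "min (t - s) 1 \<le> t - s" using that by auto
    then obtain e where "e > 0" "F t - F s \<ge> (t - s) + e" using F(3) by meson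
    then show ?thesis using that by linarith
  qed
  have FN_less: "(F ^^ N) s < (F ^^ N) t" if "s < t" for s t N
    by (induction N) (use that F_less in auto)
  have FN_surj: "surj (F ^^ N)" for N
    by (simp add: F(2) surj_fn)
  have FN_proj: "proj ((F ^^ N) t) = (T ^^ N) (proj t)" for N t
    by (induction N) (auto simp: F(1))
  have FN_growth: "(F ^^ N) (s + l) - (F ^^ N) s \<ge> l + real N * \<eta>" for N s
  proof (induction N)
    case (Suc N)
    have "l \<le> (F ^^ N) (s + l) - (F ^^ N) s"
      using Suc \<eta>(1) by (smt (verit) mult_nonneg_nonneg of_nat_0_le_iff)
    from \<eta>(2)[OF this] Suc show ?case by (simp add: algebra_simps)
  qed simp
  obtain N where N: "real N * \<eta> > 1"
    using reals_Archimedean3[OF \<eta>(1)] by blast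
  have "\<exists>y. dist y z < \<delta> \<and> (T ^^ N) y = x" for x z
  proof -
    let ?a = "coord z"
    define m where "m = \<lceil>(F ^^ N) ?a - coord x\<rceil>"
    have m: "(F ^^ N) ?a \<le> coord x + of_int m" "coord x + of_int m < (F ^^ N) ?a + 1"
      unfolding m_def by linarith+
    obtain t where t: "(F ^^ N) t = coord x + of_int m"
      using FN_surj by (metis surjE)
    have "(F ^^ N) t \<le> (F ^^ N) (?a + l)"
      using FN_growth[of N ?a] N l(1) m(2) t by linarith
    then have "?a \<le> t" "t \<le> ?a + l"
      using m(1) t FN_less by (metis linorder_not_less)+
    then have "dist (proj t) z < \<delta>"
      using dist_proj_le[of t ?a] l(3) by simp
    moreover have "(T ^^ N) (proj t) = x"
      by (metis FN_proj t proj_add_int proj_coord)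
    ultimately show ?thesis by blast
  qed
  then show ?thesis by blast
qed

section \<open>Inverse branches from compatibility\<close>

lemma preorbit_through:
  assumes "surj T" "T z = p"
  obtains x where "x \<in> preorbits T p" "x 1 = z"
proof (rule that[of "case_nat p (\<lambda>j. (inv T ^^ j) z)"])
  show "case_nat p (\<lambda>j. (inv T ^^ j) z) \<in> preorbits T p"
    using assms by (auto simp: preorbits_def surj_f_inv_f split: nat.split)
qed simp

lemma tracks_sym: "tracks \<omega> \<Omega> C x y \<longleftrightarrow> tracks \<omega> \<Omega> C y x"
  by (simp add: tracks_def dist_commute)

lemma tracks_Cons:
  assumes "tracks \<omega> \<Omega> C x y"
    and "dist (x 0) (y 0) \<le> dist p q"
    and "\<Omega> (dist (x 0) (y 0)) + C * \<omega> (dist (x 0) (y 0)) \<le> \<Omega> (dist p q)"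
  shows "tracks \<omega> \<Omega> C (case_nat p x) (case_nat q y)"
  unfolding tracks_def
proof (intro allI impI)
  fix k :: nat assume "1 \<le> k"
  then obtain j where k: "k = Suc j" by (cases k) auto
  have "(\<Sum>i=1..Suc j. \<omega> (dist (case_nat p x i) (case_nat q y i)))
      = (\<Sum>i=0..j. \<omega> (dist (x i) (y i)))"
    using sum.shift_bounds_cl_Suc_ivl[of "\<lambda>i. \<omega> (dist (case_nat p x i) (case_nat q y i))" 0 j]
    by simp
  also have "\<dots> = \<omega> (dist (x 0) (y 0)) + (\<Sum>i=1..j. \<omega> (dist (x i) (y i)))"
    by (simp add: sum.atLeast_Suc_atMost)
  finally have s: "(\<Sum>i=1..Suc j. \<omega> (dist (case_nat p x i) (case_nat q y i)))
      = \<omega> (dist (x 0) (y 0)) + (\<Sum>i=1..j. \<omega> (dist (x i) (y i)))" .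
  show "dist (case_nat p x k) (case_nat q y k) \<le> dist (case_nat p x 0) (case_nat q y 0) \<and>
    \<Omega> (dist (case_nat p x k) (case_nat q y k)) +
      C * (\<Sum>i=1..k. \<omega> (dist (case_nat p x i) (case_nat q y i)))
    \<le> \<Omega> (dist (case_nat p x 0) (case_nat q y 0))"
  proof (cases j)
    case 0
    then show ?thesis using assms(2,3) s k by simp
  next
    case (Suc i)
    then have "dist (x j) (y j) \<le> dist (x 0) (y 0)"
      "\<Omega> (dist (x j) (y j)) + C * (\<Sum>i=1..j. \<omega> (dist (x i) (y i))) \<le> \<Omega> (dist (x 0) (y 0))"
      using assms(1) by (auto simp: tracks_def)
    then show ?thesis using assms(2,3) unfolding k s by (simp add: distrib_left)
  qed
qed

text \<open>Compatibility speaks of infinite pre-orbits; the transfer operator needs only their first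
  step. The first point of the tracking pre-orbit depends only on the first point of the given one:
  otherwise, restarting the tracking after one step and putting the base points in front would
  produce a second tracking pre-orbit. By symmetry of tracking, the induced map between the fibres
  is a bijection.\<close>

lemma compatible_branches:
  assumes "surj T" and "compatible T \<omega> \<Omega>"
  obtains \<rho> C where "\<rho> > 0" "C > 0"
    "\<And>p q. dist p q < \<rho> \<Longrightarrow> \<exists>\<pi>. bij_betw \<pi> (T -` {p}) (T -` {q}) \<and>
       (\<forall>z\<in>T -` {p}. dist z (\<pi> z) \<le> dist p q \<and>
          \<Omega> (dist z (\<pi> z)) + C * \<omega> (dist z (\<pi> z)) \<le> \<Omega> (dist p q))"
proof -
  obtain \<rho> C where \<rho>: "\<rho> > 0" and C: "C > 0" and
    all: "\<forall>p q. dist p q < \<rho> \<longrightarrow>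
        (\<forall>x\<in>preorbits T p. \<exists>!y. y \<in> preorbits T q \<and> tracks \<omega> \<Omega> C x y) \<and>
        bij_betw (\<lambda>x. THE y. y \<in> preorbits T q \<and> tracks \<omega> \<Omega> C x y)
          (preorbits T p) (preorbits T q)"
    using assms(2) unfolding compatible_def by (elim exE conjE)
  have ex1: "\<exists>!y. y \<in> preorbits T q \<and> tracks \<omega> \<Omega> C x y"
    if "dist p q < \<rho>" "x \<in> preorbits T p" for p q x
    by (rule bspec[OF conjunct1[OF all[rule_format, OF that(1)]] that(2)])
  define rel where "rel p q z w \<longleftrightarrow> (\<exists>x\<in>preorbits T p. \<exists>y\<in>preorbits T q.
    tracks \<omega> \<Omega> C x y \<and> x 1 = z \<and> y 1 = w)" for p q z w
  have rel_sym: "rel q p w z" if r: "rel p q z w" for p q z w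
  proof -
    obtain x y where "x \<in> preorbits T p" "y \<in> preorbits T q" "tracks \<omega> \<Omega> C x y" "x 1 = z" "y 1 = w"
      using r unfolding rel_def by (elim bexE conjE)
    then show ?thesis
      unfolding rel_def tracks_sym[of \<omega> \<Omega> C x y] by (intro bexI conjI)
  qed
  have rel_ex: "\<exists>w. rel p q z w" if d: "dist p q < \<rho>" and "T z = p" for p q z
  proof -
    obtain x where x: "x \<in> preorbits T p" "x 1 = z"
      by (rule preorbit_through[OF assms(1) \<open>T z = p\<close>])
    obtain y where "y \<in> preorbits T q" "tracks \<omega> \<Omega> C x y"
      using ex1[OF d x(1)] by (elim ex1E conjE)
    with x have "rel p q z (y 1)"
      unfolding rel_def by (intro bexI[of _ x] bexI[of _ y] conjI refl)
    then show ?thesis ..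
  qed
  have rel_fib: "T z = p \<and> T w = q" if r: "rel p q z w" for p q z w
  proof -
    obtain x y where x: "x \<in> preorbits T p" "x 1 = z" and y: "y \<in> preorbits T q" "y 1 = w"
      using r unfolding rel_def by (elim bexE conjE) blast
    have "T (x (Suc 0)) = x 0" "x 0 = p" "T (y (Suc 0)) = y 0" "y 0 = q"
      using x(1) y(1) unfolding preorbits_def by simp_all
    then show ?thesis using x(2) y(2) by simp
  qed
  have rel_bound: "dist z w \<le> dist p q \<and> \<Omega> (dist z w) + C * \<omega> (dist z w) \<le> \<Omega> (dist p q)"
    if "rel p q z w" for p q z w
  proof -
    obtain x y where xy: "x 0 = p" "y 0 = q" "x 1 = z" "y 1 = w" "tracks \<omega> \<Omega> C x y"
      using \<open>rel p q z w\<close> unfolding rel_def preorbits_def mem_Collect_eq by (elim bexE conjE) blast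
    from xy(5)[unfolded tracks_def, rule_format, of 1] xy(1-4) show ?thesis by simp
  qed
  have rel_unique: "w = w'" if d: "dist p q < \<rho>" and r: "rel p q z w" "rel p q z w'" for p q z w w'
  proof -
    obtain x y where x: "x \<in> preorbits T p" "x 1 = z"
      and y: "y \<in> preorbits T q" "tracks \<omega> \<Omega> C x y" "y 1 = w"
      using r(1) unfolding rel_def by (elim bexE conjE)
    define x' where "x' k = x (Suc k)" for k
    have x': "x' \<in> preorbits T z" using x by (auto simp: preorbits_def x'_def)
    have "dist z w' < \<rho>" using rel_bound[OF r(2)] d by linarith
    then obtain y' where y': "y' \<in> preorbits T w'" "tracks \<omega> \<Omega> C x' y'"
      using ex1[OF \<open>dist z w' < \<rho>\<close> x'] by (elim ex1E conjE)
    have 0: "x' 0 = z" "y' 0 = w'" using x' y' by (auto simp: preorbits_def)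
    have "tracks \<omega> \<Omega> C (case_nat p x') (case_nat q y')"
      using rel_bound[OF r(2)] by (intro tracks_Cons y') (simp_all add: 0)
    moreover have "case_nat p x' = x"
      using x by (auto simp: fun_eq_iff x'_def preorbits_def split: nat.split)
    moreover have "case_nat q y' \<in> preorbits T q"
      using y' rel_fib[OF r(2)] by (auto simp: preorbits_def split: nat.split)
    ultimately have "case_nat q y' = y"
      using ex1[OF d x(1)] y(1,2) by (elim ex1E) blast
    then show ?thesis using y(3) 0(2) by auto
  qed
  show thesis
  proof (rule that[OF \<rho> C])
    fix p q :: circle assume d: "dist p q < \<rho>"
    then have d': "dist q p < \<rho>" by (simp add: dist_commute)
    define \<pi> where "\<pi> z = (SOME w. rel p q z w)" for z
    have \<pi>: "rel p q z (\<pi> z)" if "T z = p" for z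
      unfolding \<pi>_def by (rule someI_ex[OF rel_ex[OF d that]])
    have "bij_betw \<pi> (T -` {p}) (T -` {q})"
      unfolding bij_betw_def
    proof
      show "inj_on \<pi> (T -` {p})"
        
      proof (rule inj_onI)
        fix z z' assume "z \<in> T -` {p}" "z' \<in> T -` {p}" "\<pi> z = \<pi> z'"
        then have "rel q p (\<pi> z) z" "rel q p (\<pi> z) z'"
          using rel_sym[OF \<pi>[of z]] rel_sym[OF \<pi>[of z']] by auto
        then show "z = z'" by (rule rel_unique[OF d'])
      qed
      show "\<pi> ` (T -` {p}) = T -` {q}"
      proof
        show "\<pi> ` (T -` {p}) \<subseteq> T -` {q}" using rel_fib[OF \<pi>] by auto
        show "T -` {q} \<subseteq> \<pi> ` (T -` {p})"
        proof
          fix w assume "w \<in> T -` {q}"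
          then have "T w = q" by simp
          from rel_ex[OF d' this] obtain z where "rel q p w z" ..
          then have z: "rel p q z w" by (rule rel_sym)
          then have "T z = p" using rel_fib[OF z] by simp
          then have "\<pi> z = w" by (intro rel_unique[OF d \<pi> z])
          then show "w \<in> \<pi> ` (T -` {p})" using \<open>T z = p\<close> by blast
        qed
      qed
    qed
    then show "\<exists>\<pi>. bij_betw \<pi> (T -` {p}) (T -` {q}) \<and>
       (\<forall>z\<in>T -` {p}. dist z (\<pi> z) \<le> dist p q \<and>
          \<Omega> (dist z (\<pi> z)) + C * \<omega> (dist z (\<pi> z)) \<le> \<Omega> (dist p q))"
      using rel_bound[OF \<pi>] by (intro exI[of _ \<pi>]) auto
  qed
qed

section \<open>Contraction of ratios of iterates\<close>

text \<open>What the convergence proof needs of the map and the potential. The function \<^term>\<open>\<theta>\<close> is a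
  multiple of \<open>\<Omega>\<close>, scaled so that the gain of \<open>\<Omega>\<close> along an inverse branch pays for the variation
  of \<^term>\<open>f\<close> there.\<close>

locale branching_operator =
  fixes T :: "circle \<Rightarrow> circle" and f :: "circle \<Rightarrow> real" and \<theta> :: "real \<Rightarrow> real" and \<rho> B :: real
  assumes finite_fib: "\<And>x. finite (T -` {x})"
    and surj_T: "surj T"
    and \<rho>_pos: "0 < \<rho>"
    and \<theta>_mono: "mono_on {0..} \<theta>" and \<theta>_zero: "\<theta> 0 = 0"
    and \<theta>_small: "\<And>\<epsilon>. 0 < \<epsilon> \<Longrightarrow> \<exists>\<delta>>0. \<theta> \<delta> < \<epsilon>"
    and branch: "\<And>p q. dist p q < \<rho> \<Longrightarrow> \<exists>\<pi>. bij_betw \<pi> (T -` {p}) (T -` {q}) \<and>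
       (\<forall>z\<in>T -` {p}. dist z (\<pi> z) \<le> dist p q \<and> f z + \<theta> (dist z (\<pi> z)) \<le> f (\<pi> z) + \<theta> (dist p q))"
    and f_bound: "\<And>x. \<bar>f x\<bar> \<le> B"
    and mixing: "\<And>\<delta>. 0 < \<delta> \<Longrightarrow> \<exists>N. \<forall>x z. \<exists>y. dist y z < \<delta> \<and> (T ^^ N) y = x"
begin

abbreviation L :: "(circle \<Rightarrow> real) \<Rightarrow> circle \<Rightarrow> real" where
  "L \<equiv> transfer_op T f"

lemma \<theta>_le: "0 \<le> s \<Longrightarrow> s \<le> t \<Longrightarrow> \<theta> s \<le> \<theta> t"
  using mono_onD[OF \<theta>_mono, of s t] by auto

lemma \<theta>_nonneg: "0 \<le> t \<Longrightarrow> 0 \<le> \<theta> t"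
  using \<theta>_le[of 0 t] \<theta>_zero by simp

lemma L_eq: "L \<phi> x = (\<Sum>y\<in>T -` {x}. exp (f y) * \<phi> y)"
  by (simp add: transfer_op_def)

lemma fib_nonempty: "T -` {x} \<noteq> {}"
  using surj_T by (metis empty_iff surjE vimage_singleton_eq)

lemma L_lin: "L (\<lambda>x. a * \<phi> x + b * \<psi> x) = (\<lambda>x. a * L \<phi> x + b * L \<psi> x)"
  by (auto simp: L_eq sum.distrib sum_distrib_left algebra_simps)

lemma Ln_lin: "(L ^^ n) (\<lambda>x. a * \<phi> x + b * \<psi> x) = (\<lambda>x. a * (L ^^ n) \<phi> x + b * (L ^^ n) \<psi> x)"
  by (induction n) (auto simp: L_lin)

lemma Ln_cmult: "(L ^^ n) (\<lambda>x. a * \<phi> x) = (\<lambda>x. a * (L ^^ n) \<phi> x)"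
  using Ln_lin[of n a \<phi> 0 \<phi>] by simp

lemma Ln_add: "(L ^^ (m + n)) \<phi> = (L ^^ m) ((L ^^ n) \<phi>)"
  by (simp add: funpow_add)

lemma L_mono: "(\<And>x. \<phi> x \<le> \<psi> x) \<Longrightarrow> L \<phi> x \<le> L \<psi> x"
  by (auto simp: L_eq intro!: sum_mono)

lemma Ln_mono: "(\<And>x. \<phi> x \<le> \<psi> x) \<Longrightarrow> (L ^^ n) \<phi> x \<le> (L ^^ n) \<psi> x"
  by (induction n arbitrary: x) (auto intro: L_mono)

lemma L_pos: "(\<And>x. 0 < \<phi> x) \<Longrightarrow> 0 < L \<phi> x"
  unfolding L_eq by (intro sum_pos finite_fib fib_nonempty) auto

text \<open>A single branch of \<open>T\<^sup>n\<close> contributes at least this much to the sum over all branches.\<close>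

lemma Ln_lower:
  assumes "\<And>x. 0 \<le> \<phi> x"
  shows "exp (- (real n * B)) * \<phi> y \<le> (L ^^ n) \<phi> ((T ^^ n) y)"
proof (induction n)
  case (Suc n)
  let ?w = "(T ^^ n) y"
  have nn: "0 \<le> (L ^^ n) \<phi> x" for x
    using Ln_mono[of "\<lambda>x. 0 * \<phi> x" \<phi> n x] assms by (simp only: Ln_cmult) simp
  have "exp (- (real (Suc n) * B)) * \<phi> y = exp (- B) * (exp (- (real n * B)) * \<phi> y)"
    by (simp add: exp_add[symmetric] algebra_simps)
  also have "\<dots> \<le> exp (f ?w) * (L ^^ n) \<phi> ?w"
    using f_bound[of ?w] nn assms Suc by (intro mult_mono) auto
  also have "\<dots> \<le> L ((L ^^ n) \<phi>) (T ?w)"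
    unfolding L_eq[of "(L ^^ n) \<phi>"]
    by (rule member_le_sum[of ?w "T -` {T ?w}" "\<lambda>y. exp (f y) * (L ^^ n) \<phi> y"])
      (use nn finite_fib in auto)
  finally show ?case by simp
qed simp

text \<open>The central notion: local control of the oscillation of the logarithm. The function
  \<^term>\<open>\<theta>\<close> absorbs what one step of the operator adds, and the slack \<^term>\<open>\<epsilon>\<close> survives because
  inverse branches do not expand, so every positive continuous function stays under uniform
  control along its iterates.\<close>

definition log_cont :: "real \<Rightarrow> real \<Rightarrow> (circle \<Rightarrow> real) \<Rightarrow> bool" where
  "log_cont \<delta> \<epsilon> \<phi> \<longleftrightarrow> (\<forall>x. 0 < \<phi> x) \<and>
     (\<forall>p q. dist p q < \<delta> \<longrightarrow> \<phi> p \<le> \<phi> q * exp (\<theta> (dist p q) + \<epsilon>))"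

lemma log_contD:
  assumes "log_cont \<delta> \<epsilon> \<phi>"
  shows "0 < \<phi> x" "dist p q < \<delta> \<Longrightarrow> \<phi> p \<le> \<phi> q * exp (\<theta> (dist p q) + \<epsilon>)"
  using assms by (auto simp: log_cont_def)

lemma L_log_cont:
  assumes "\<delta> \<le> \<rho>" and \<phi>: "log_cont \<delta> \<epsilon> \<phi>"
  shows "log_cont \<delta> \<epsilon> (L \<phi>)"
  unfolding log_cont_def
proof (intro conjI allI impI)
  show "0 < L \<phi> x" for x by (rule L_pos[OF log_contD(1)[OF \<phi>]])
  fix p q :: circle assume d: "dist p q < \<delta>"
  obtain \<pi> where bij: "bij_betw \<pi> (T -` {p}) (T -` {q})"
    and \<pi>: "\<And>z. z \<in> T -` {p} \<Longrightarrow> dist z (\<pi> z) \<le> dist p q"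
      "\<And>z. z \<in> T -` {p} \<Longrightarrow> f z + \<theta> (dist z (\<pi> z)) \<le> f (\<pi> z) + \<theta> (dist p q)"
    using branch[of p q] d assms(1) by fastforce
  have "exp (f z) * \<phi> z \<le> exp (f (\<pi> z)) * \<phi> (\<pi> z) * exp (\<theta> (dist p q) + \<epsilon>)"
    if z: "z \<in> T -` {p}" for z
  proof -
    have "exp (f z) * \<phi> z \<le> exp (f z) * (\<phi> (\<pi> z) * exp (\<theta> (dist z (\<pi> z)) + \<epsilon>))"
      using \<pi>(1)[OF z] d by (intro mult_left_mono log_contD(2)[OF \<phi>]) auto
    also have "\<dots> = \<phi> (\<pi> z) * exp (f z + \<theta> (dist z (\<pi> z)) + \<epsilon>)"
      by (simp add: exp_add)
    also have "\<dots> \<le> \<phi> (\<pi> z) * exp (f (\<pi> z) + \<theta> (dist p q) + \<epsilon>)"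
      using \<pi>(2)[OF z] log_contD(1)[OF \<phi>, of "\<pi> z"] by (intro mult_left_mono) auto
    finally show ?thesis by (simp add: exp_add mult_ac)
  qed
  then have "L \<phi> p \<le> (\<Sum>z\<in>T -` {p}. exp (f (\<pi> z)) * \<phi> (\<pi> z) * exp (\<theta> (dist p q) + \<epsilon>))"
    unfolding L_eq by (rule sum_mono)
  also have "\<dots> = (\<Sum>w\<in>T -` {q}. exp (f w) * \<phi> w * exp (\<theta> (dist p q) + \<epsilon>))"
    by (rule sum.reindex_bij_betw[OF bij])
  finally show "L \<phi> p \<le> L \<phi> q * exp (\<theta> (dist p q) + \<epsilon>)"
    by (simp add: L_eq sum_distrib_right)
qed

lemma Ln_log_cont: "\<delta> \<le> \<rho> \<Longrightarrow> log_cont \<delta> \<epsilon> \<phi> \<Longrightarrow> log_cont \<delta> \<epsilon> ((L ^^ n) \<phi>)"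
  by (induction n) (auto intro: L_log_cont)

lemma continuous_imp_log_cont:
  assumes "continuous_on UNIV \<phi>" "\<And>x. 0 < \<phi> x" "0 < \<epsilon>"
  obtains \<delta> where "0 < \<delta>" "\<delta> \<le> \<rho>" "log_cont \<delta> \<epsilon> \<phi>"
proof -
  have "continuous_on UNIV (\<lambda>x. ln (\<phi> x))"
    by (intro continuous_on_ln assms(1)) (metis assms(2) less_irrefl)
  then have "uniformly_continuous_on UNIV (\<lambda>x. ln (\<phi> x))"
    by (intro compact_uniformly_continuous compact_circle)
  then obtain d where d: "d > 0" "\<And>p q. dist p q < d \<Longrightarrow> dist (ln (\<phi> p)) (ln (\<phi> q)) < \<epsilon>"
    using assms(3) unfolding uniformly_continuous_on_def by (metis UNIV_I)
  show thesis
  proof (rule that[of "min d \<rho>"])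
    show "log_cont (min d \<rho>) \<epsilon> \<phi>"
      unfolding log_cont_def
    proof (intro conjI allI impI assms(2))
      fix p q :: circle assume "dist p q < min d \<rho>"
      then have "ln (\<phi> p) \<le> ln (\<phi> q) + \<epsilon>"
        using d(2)[of p q] by (auto simp: dist_real_def)
      also have "\<dots> \<le> ln (\<phi> q) + (\<theta> (dist p q) + \<epsilon>)"
        using \<theta>_nonneg[of "dist p q"] by simp
      finally have "exp (ln (\<phi> p)) \<le> exp (ln (\<phi> q) + (\<theta> (dist p q) + \<epsilon>))"
        by simp
      then show "\<phi> p \<le> \<phi> q * exp (\<theta> (dist p q) + \<epsilon>)"
        using assms(2)[of p] assms(2)[of q] by (simp only: exp_add[of "ln (\<phi> q)"] exp_ln)
    qed
  qed (use d \<rho>_pos in auto)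
qed

text \<open>The continuity of \<open>L \<phi>\<close> is not evident, since the preimages of a point are not given by globally
  continuous branches. It is read off from the estimates that the operator preserves.\<close>

lemma log_cont_imp_continuous:
  assumes "\<And>\<epsilon>. 0 < \<epsilon> \<Longrightarrow> \<exists>\<delta>>0. log_cont \<delta> \<epsilon> \<phi>"
  shows "continuous_on UNIV \<phi>"
proof -
  have pos: "0 < \<phi> x" for x
    using assms[of 1] log_contD(1) by auto
  have "continuous_on UNIV (\<lambda>x. ln (\<phi> x))"
    unfolding continuous_on_iff
  proof (intro ballI allI impI)
    fix q :: circle and e :: real assume "0 < e"
    obtain \<delta> where \<delta>: "\<delta> > 0" "log_cont \<delta> (e / 2) \<phi>"
      using assms[of "e / 2"] \<open>0 < e\<close> by auto
    obtain d where d: "d > 0" "\<theta> d < e / 2"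
      using \<theta>_small[of "e / 2"] \<open>0 < e\<close> by auto
    have less: "ln (\<phi> x) < ln (\<phi> y) + e" if "dist x y < min \<delta> d" for x y
    proof -
      have "ln (\<phi> x) \<le> ln (\<phi> y * exp (\<theta> (dist x y) + e / 2))"
        using log_contD(2)[OF \<delta>(2), of x y] that pos by (intro ln_mono) auto
      also have "\<dots> = ln (\<phi> y) + (\<theta> (dist x y) + e / 2)"
        using pos[of y] by (simp add: ln_mult_pos)
      also have "\<dots> < ln (\<phi> y) + e"
        using \<theta>_le[of "dist x y" d] that d by auto
      finally show ?thesis .
    qed
    show "\<exists>d>0. \<forall>x'\<in>UNIV. dist x' q < d \<longrightarrow> dist (ln (\<phi> x')) (ln (\<phi> q)) < e"
    proof (intro exI[of _ "min \<delta> d"] conjI ballI impI)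
      fix x' :: circle assume "dist x' q < min \<delta> d"
      then show "dist (ln (\<phi> x')) (ln (\<phi> q)) < e"
        using less[of x' q] less[of q x'] by (auto simp: dist_commute dist_real_def abs_less_iff)
    qed (use \<delta> d in auto)
  qed
  then have "continuous_on UNIV (\<lambda>x. exp (ln (\<phi> x)))"
    by (rule continuous_on_exp)
  then show ?thesis using pos by simp
qed

lemma continuous_bounded:
  assumes "continuous_on UNIV (\<phi> :: circle \<Rightarrow> real)"
  obtains M where "0 < M" "\<And>x. \<bar>\<phi> x\<bar> < M"
proof -
  have "bounded (range \<phi>)"
    using assms by (intro compact_imp_bounded compact_continuous_image compact_circle)
  then obtain M where "M > 0" "\<And>x. \<bar>\<phi> x\<bar> \<le> M"
    unfolding bounded_pos by auto
  then show thesis by (intro that[of "M + 1"]) (simp_all add: add.commute add_strict_increasing)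
qed

lemma Ln_continuous:
  assumes "continuous_on UNIV \<phi>"
  shows "continuous_on UNIV ((L ^^ n) \<phi>)"
proof -
  have pos: "continuous_on UNIV ((L ^^ n) \<psi>)"
    if "continuous_on UNIV \<psi>" "\<And>x. 0 < \<psi> x" for \<psi>
  proof (rule log_cont_imp_continuous)
    fix \<epsilon> :: real assume "0 < \<epsilon>"
    with continuous_imp_log_cont[OF that] Ln_log_cont
    show "\<exists>\<delta>>0. log_cont \<delta> \<epsilon> ((L ^^ n) \<psi>)" by metis
  qed
  obtain M where M: "0 < M" "\<And>x. \<bar>\<phi> x\<bar> < M" using continuous_bounded[OF assms] by blast
  \<comment> \<open>The logarithmic estimates concern positive functions; a constant shift makes \<^term>\<open>\<phi>\<close> positive.\<close>
  have eq: "\<phi> = (\<lambda>x. 1 * (\<phi> x + M) + (- M) * 1)" by auto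
  have "(L ^^ n) \<phi> = (\<lambda>x. 1 * (L ^^ n) (\<lambda>x. \<phi> x + M) x + (- M) * (L ^^ n) (\<lambda>_. 1) x)"
    by (subst eq, subst Ln_lin) simp
  moreover have "continuous_on UNIV ((L ^^ n) (\<lambda>x. \<phi> x + M))"
  proof (rule pos)
    show "0 < \<phi> x + M" for x using M(2)[of x] by linarith
  qed (intro continuous_intros assms)
  moreover have "continuous_on UNIV ((L ^^ n) (\<lambda>_. 1))"
    by (rule pos) auto
  ultimately show ?thesis by (auto intro!: continuous_intros)
qed

definition iter_one :: "nat \<Rightarrow> circle \<Rightarrow> real" where
  "iter_one n = (L ^^ n) (\<lambda>_. 1)"

definition ratio :: "nat \<Rightarrow> (circle \<Rightarrow> real) \<Rightarrow> circle \<Rightarrow> real" where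
  "ratio n \<phi> x = (L ^^ n) \<phi> x / iter_one n x"

lemma iter_one_log_cont: "log_cont \<rho> 0 (iter_one n)"
proof -
  have "log_cont \<rho> 0 (\<lambda>_. 1)"
    using \<theta>_nonneg by (auto simp: log_cont_def)
  then show ?thesis unfolding iter_one_def by (intro Ln_log_cont) auto
qed

lemma iter_one_pos: "0 < iter_one n x"
  by (rule log_contD(1)[OF iter_one_log_cont])

lemma iter_one_continuous: "continuous_on UNIV (iter_one n)"
  unfolding iter_one_def by (rule Ln_continuous) auto

lemma Ln_iter_one: "(L ^^ m) (iter_one n) = iter_one (m + n)"
  by (simp add: iter_one_def Ln_add)

lemma log_cont_global:
  obtains N where "\<And>\<phi> p q. log_cont \<rho> 0 \<phi> \<Longrightarrow> \<phi> p \<le> \<phi> q * exp (real N * \<theta> (dist p q))"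
proof -
  obtain N where N: "1 / \<rho> < real N" using reals_Archimedean2 by blast
  have "\<phi> p \<le> \<phi> q * exp (real N * \<theta> (dist p q))" if \<phi>: "log_cont \<rho> 0 \<phi>" for \<phi> p q
    by (rule global_from_local_log_bound[OF \<rho>_pos \<theta>_mono _ _ N])
      (use log_contD[OF \<phi>] in \<open>auto simp: less_imp_le\<close>)
  then show thesis by (rule that)
qed

text \<open>Since \<^term>\<open>\<theta>\<close> is bounded on the range of the distance, the members of the invariant cone have
  uniformly comparable values, however often the operator has been applied.\<close>

lemma distortion:
  obtains D where "1 \<le> D" "\<And>\<phi> p q. log_cont \<rho> 0 \<phi> \<Longrightarrow> \<phi> p \<le> D * \<phi> q"
proof -
  obtain N where N: "\<And>\<phi> p q. log_cont \<rho> 0 \<phi> \<Longrightarrow> \<phi> p \<le> \<phi> q * exp (real N * \<theta> (dist p q))"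
    using log_cont_global by blast
  show thesis
  proof (rule that[of "exp (real N * \<theta> 1)"])
    show "1 \<le> exp (real N * \<theta> 1)" using \<theta>_nonneg by simp
    fix \<phi> p q assume \<phi>: "log_cont \<rho> 0 \<phi>"
    have "\<phi> p \<le> \<phi> q * exp (real N * \<theta> (dist p q))" by (rule N[OF \<phi>])
    also have "\<dots> \<le> \<phi> q * exp (real N * \<theta> 1)"
      using log_contD(1)[OF \<phi>, of q] \<theta>_le[OF _ dist_le_one[of p q]]
      by (intro mult_left_mono) (auto simp: mult_left_mono)
    finally show "\<phi> p \<le> exp (real N * \<theta> 1) * \<phi> q" by (simp add: mult.commute)
  qed
qed

text \<open>Uniform comparability turns a multiplicative estimate into an additive one, of which \<^term>\<open>\<theta>\<close>
  is the modulus; this is where the regularity of the eigenfunction comes from.\<close>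

lemma log_cont_imp_modulus:
  assumes "log_cont \<rho> 0 \<phi>"
  obtains C where "0 < C" "\<And>x y. \<bar>\<phi> x - \<phi> y\<bar> \<le> C * \<theta> (dist x y)"
proof -
  obtain N where N: "\<And>p q. \<phi> p \<le> \<phi> q * exp (real N * \<theta> (dist p q))"
    using log_cont_global assms by metis
  obtain D where D: "1 \<le> D" "\<And>\<phi> p q. log_cont \<rho> 0 \<phi> \<Longrightarrow> \<phi> p \<le> D * \<phi> q"
    using distortion by blast
  define M where "M = D * \<phi> (Circle 0)"
  have M: "\<phi> x \<le> M" for x unfolding M_def by (rule D(2)[OF assms])
  have \<phi>_pos: "0 < \<phi> x" for x by (rule log_contD(1)[OF assms])
  have M_pos: "0 < M" using M \<phi>_pos by (metis less_le_trans)
  define C where "C = M * (real N + 1) * exp (real N * \<theta> 1)"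
  have le: "\<phi> x - \<phi> y \<le> C * \<theta> (dist x y)" for x y
  proof -
    define s where "s = real N * \<theta> (dist x y)"
    have \<theta>d: "0 \<le> \<theta> (dist x y)" "\<theta> (dist x y) \<le> \<theta> 1"
      using \<theta>_nonneg \<theta>_le dist_le_one by auto
    have s: "0 \<le> s" "s \<le> real N * \<theta> 1" "s \<le> (real N + 1) * \<theta> (dist x y)"
      using \<theta>d by (auto simp: s_def intro!: mult_left_mono mult_right_mono)
    \<comment> \<open>This is \<open>1 - s \<le> exp (- s)\<close> multiplied by \<open>exp s\<close>.\<close>
    have "exp s - 1 \<le> s * exp s"
      using exp_ge_add_one_self[of "- s"] by (simp add: exp_minus field_simps)
    also have "\<dots> \<le> ((real N + 1) * \<theta> (dist x y)) * exp (real N * \<theta> 1)"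
      using s by (intro mult_mono) auto
    finally have e: "exp s - 1 \<le> (real N + 1) * \<theta> (dist x y) * exp (real N * \<theta> 1)" .
    have "\<phi> x - \<phi> y \<le> \<phi> y * (exp s - 1)"
      using N[of x y] by (simp add: s_def algebra_simps)
    also have "\<dots> \<le> M * ((real N + 1) * \<theta> (dist x y) * exp (real N * \<theta> 1))"
      using M[of y] M_pos e s(1) by (intro mult_mono) auto
    finally show ?thesis by (simp add: C_def mult_ac)
  qed
  show thesis
  proof (rule that[of C])
    show "0 < C" using M_pos by (simp add: C_def add_nonneg_pos)
    show "\<bar>\<phi> x - \<phi> y\<bar> \<le> C * \<theta> (dist x y)" for x y
      using le[of x y] le[of y x] by (simp add: dist_commute abs_le_iff)
  qed
qed

lemma ratio_le_iff: "ratio n \<phi> x \<le> b \<longleftrightarrow> (L ^^ n) \<phi> x \<le> b * iter_one n x"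
  using iter_one_pos[of n x] by (simp add: ratio_def field_simps)

lemma le_ratio_iff: "a \<le> ratio n \<phi> x \<longleftrightarrow> a * iter_one n x \<le> (L ^^ n) \<phi> x"
  using iter_one_pos[of n x] by (simp add: ratio_def field_simps)

lemma ratio_0 [simp]: "ratio 0 \<phi> = \<phi>"
  by (auto simp: ratio_def iter_one_def)

lemma ratio_bounds_mono:
  assumes "\<And>x. a \<le> ratio n \<phi> x \<and> ratio n \<phi> x \<le> b" and "n \<le> k"
  shows "a \<le> ratio k \<phi> x \<and> ratio k \<phi> x \<le> b"
proof -
  obtain m where k: "k = m + n" using assms(2) by (metis add.commute le_Suc_ex)
  have "(L ^^ m) (\<lambda>x. a * iter_one n x) x \<le> (L ^^ m) ((L ^^ n) \<phi>) x"
    using assms(1) by (intro Ln_mono) (auto simp: le_ratio_iff)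
  moreover have "(L ^^ m) ((L ^^ n) \<phi>) x \<le> (L ^^ m) (\<lambda>x. b * iter_one n x) x"
    using assms(1) by (intro Ln_mono) (auto simp: ratio_le_iff)
  ultimately show ?thesis
    by (simp add: ratio_le_iff le_ratio_iff k Ln_cmult Ln_iter_one Ln_add)
qed

text \<open>The function \<open>b L\<^sup>n 1 - L\<^sup>n \<phi>\<close> is nonnegative, so applying \<open>L\<^sup>N\<close> to it keeps at least the
  contribution of one preimage \<^term>\<open>y\<close>. By mixing that preimage can be taken close to any prescribed
  point \<^term>\<open>z\<close>, and distortion makes the weight \<^term>\<open>c\<close> of the contribution independent of
  \<^term>\<open>n\<close> and \<^term>\<open>\<phi>\<close>.\<close>

lemma ratio_improve:
  assumes "0 < \<delta>"
  obtains N c where "0 < c" "c \<le> 1"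
    "\<And>\<phi> n b x z. (\<And>x. ratio n \<phi> x \<le> b) \<Longrightarrow>
       \<exists>y. dist y z < \<delta> \<and> ratio (N + n) \<phi> x \<le> b - c * (b - ratio n \<phi> y)"
proof -
  obtain N where N: "\<And>x z. \<exists>y. dist y z < \<delta> \<and> (T ^^ N) y = x"
    using mixing[OF assms] by blast
  obtain D where D: "1 \<le> D" "\<And>\<phi> p q. log_cont \<rho> 0 \<phi> \<Longrightarrow> \<phi> p \<le> D * \<phi> q"
    using distortion by blast
  define A where "A = D * iter_one N (Circle 0)"
  have A: "iter_one N x \<le> A" for x unfolding A_def by (rule D(2)[OF iter_one_log_cont])
  have A_pos: "0 < A" using A iter_one_pos by (metis less_le_trans)
  define c where "c = exp (- (real N * B)) / (A * D)"
  have c_pos: "0 < c" using A_pos D(1) by (simp add: c_def)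
  have "exp (- (real N * B)) \<le> iter_one N ((T ^^ N) (Circle 0))"
    using Ln_lower[of "\<lambda>_. 1" N] by (simp add: iter_one_def)
  also have "\<dots> \<le> A" by (rule A)
  also have "\<dots> \<le> A * D" using A_pos D(1) by simp
  finally have c_le: "c \<le> 1" using A_pos D(1) by (simp add: c_def)
  show thesis
  proof (rule that[OF c_pos c_le])
    fix \<phi> n b x z assume b: "\<And>x. ratio n \<phi> x \<le> b"
    obtain y where y: "dist y z < \<delta>" "(T ^^ N) y = x" using N by blast
    define \<psi> where "\<psi> x = b * iter_one n x + (- 1) * (L ^^ n) \<phi> x" for x
    have \<psi>_nonneg: "0 \<le> \<psi> x" for x using b[of x] by (simp add: \<psi>_def ratio_le_iff)
    have \<psi>_y: "\<psi> y = (b - ratio n \<phi> y) * iter_one n y"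
      using iter_one_pos[of n y] by (simp add: \<psi>_def ratio_def field_simps)
    have "iter_one (N + n) x \<le> (L ^^ N) (\<lambda>x. (D * iter_one n y) * 1) x"
      unfolding Ln_iter_one[symmetric] using D(2)[OF iter_one_log_cont] by (intro Ln_mono) auto
    also have "\<dots> = D * iter_one n y * iter_one N x" by (simp only: Ln_cmult iter_one_def)
    also have "\<dots> \<le> D * iter_one n y * A"
      using D(1) iter_one_pos[of n y] A by (intro mult_left_mono) auto
    finally have iter_one_le: "iter_one (N + n) x \<le> A * D * iter_one n y" by (simp add: mult_ac)
    have "c * (b - ratio n \<phi> y) * iter_one (N + n) x \<le> c * (b - ratio n \<phi> y) * (A * D * iter_one n y)"
      using c_pos b[of y] iter_one_le by (intro mult_left_mono) auto
    also have "\<dots> = exp (- (real N * B)) * \<psi> y"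
      using A_pos D(1) by (simp add: c_def \<psi>_y)
    also have "\<dots> \<le> (L ^^ N) \<psi> x"
      using Ln_lower[of \<psi> N y] \<psi>_nonneg y(2) by simp
    also have "\<dots> = b * iter_one (N + n) x - (L ^^ (N + n)) \<phi> x"
      unfolding \<psi>_def Ln_lin by (simp add: Ln_iter_one Ln_add)
    finally have "ratio (N + n) \<phi> x \<le> b - c * (b - ratio n \<phi> y)"
      unfolding ratio_le_iff by (simp add: algebra_simps)
    then show "\<exists>y. dist y z < \<delta> \<and> ratio (N + n) \<phi> x \<le> b - c * (b - ratio n \<phi> y)"
      using y(1) by blast
  qed
qed

text \<open>In \<^term>\<open>N\<close> steps the length of an enclosing interval \<open>[a, b]\<close> shrinks by the factor
  \<open>1 - c / 2\<close>, up to an error \<open>c \<eta>\<close>: if the ratio is somewhere in the lower half, the upper bound can be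
  lowered; otherwise the lower bound can be raised to the midpoint at once. The errors add up to at
  most \<open>2 \<eta>\<close>. The time \<open>k0\<close> is chosen before the function.\<close>

lemma ratio_contract:
  assumes "0 < \<delta>" "0 < \<eta>" "0 < M"
  shows "\<exists>k0. \<forall>\<phi>. (\<forall>x. 0 \<le> \<phi> x \<and> \<phi> x \<le> M) \<longrightarrow>
    (\<forall>n y z. dist y z < \<delta> \<longrightarrow> ratio n \<phi> y \<le> ratio n \<phi> z + \<eta>) \<longrightarrow>
    (\<exists>a b. b - a \<le> 3 * \<eta> \<and> (\<forall>k\<ge>k0. \<forall>x. a \<le> ratio k \<phi> x \<and> ratio k \<phi> x \<le> b))"
proof -
  obtain N c where c: "0 < c" "c \<le> 1" and
    improve: "\<And>\<phi> n b x z. (\<And>x. ratio n \<phi> x \<le> b) \<Longrightarrow>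
       \<exists>y. dist y z < \<delta> \<and> ratio (N + n) \<phi> x \<le> b - c * (b - ratio n \<phi> y)"
    by (rule ratio_improve[OF assms(1)]) metis
  have step: "\<exists>a' b'. b' - a' \<le> (1 - c / 2) * (b - a) + c * \<eta> \<and>
      (\<forall>x. a' \<le> ratio (N + n) \<phi> x \<and> ratio (N + n) \<phi> x \<le> b')"
    if osc: "\<And>y z. dist y z < \<delta> \<Longrightarrow> ratio n \<phi> y \<le> ratio n \<phi> z + \<eta>"
      and ab: "\<And>x. a \<le> ratio n \<phi> x \<and> ratio n \<phi> x \<le> b" for n \<phi> a b
  proof (cases "\<exists>z. ratio n \<phi> z \<le> (a + b) / 2")
    case True
    then obtain z where z: "ratio n \<phi> z \<le> (a + b) / 2" by blast
    have "ratio (N + n) \<phi> x \<le> b - c * (b - ((a + b) / 2 + \<eta>))" for x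
    proof -
      obtain y where y: "dist y z < \<delta>" "ratio (N + n) \<phi> x \<le> b - c * (b - ratio n \<phi> y)"
        using improve[of n \<phi> b z x] ab by blast
      have "c * (b - ((a + b) / 2 + \<eta>)) \<le> c * (b - ratio n \<phi> y)"
      proof (rule mult_left_mono)
        show "b - ((a + b) / 2 + \<eta>) \<le> b - ratio n \<phi> y"
          using osc[OF y(1)] z by linarith
      qed (use c(1) in simp)
      then show ?thesis using y(2) by linarith
    qed
    moreover have "a \<le> ratio (N + n) \<phi> x" for x
      using ratio_bounds_mono[OF ab, of "N + n" x] by simp
    ultimately show ?thesis
      by (intro exI[of _ a] exI[of _ "b - c * (b - ((a + b) / 2 + \<eta>))"])
        (auto simp: field_simps)
  next
    case False
    then have "(a + b) / 2 \<le> ratio n \<phi> x \<and> ratio n \<phi> x \<le> b" for x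
      using ab by (simp add: not_le less_imp_le)
    from ratio_bounds_mono[OF this, of "N + n"]
    have "\<forall>x. (a + b) / 2 \<le> ratio (N + n) \<phi> x \<and> ratio (N + n) \<phi> x \<le> b" by simp
    moreover have "b - (a + b) / 2 \<le> (1 - c / 2) * (b - a) + c * \<eta>"
    proof -
      have "a \<le> b" using ab order_trans by blast
      then have "c * (b - a) \<le> 1 * (b - a)" using c by (intro mult_right_mono) auto
      moreover have "0 \<le> c * \<eta>" using c assms(2) by simp
      ultimately show ?thesis by (simp add: field_simps)
    qed
    ultimately show ?thesis by blast
  qed
  define q where "q = 1 - c / 2"
  have q: "0 \<le> q" "q < 1" using c by (auto simp: q_def)
  have iter: "\<exists>a b. b - a \<le> q ^ j * M + 2 * \<eta> \<and>
      (\<forall>x. a \<le> ratio (j * N) \<phi> x \<and> ratio (j * N) \<phi> x \<le> b)"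
    if \<phi>: "\<forall>x. 0 \<le> \<phi> x \<and> \<phi> x \<le> M"
      and osc: "\<forall>n y z. dist y z < \<delta> \<longrightarrow> ratio n \<phi> y \<le> ratio n \<phi> z + \<eta>" for \<phi> j
  proof (induction j)
    case 0
    show ?case using \<phi> assms(2) by (intro exI[of _ 0] exI[of _ M]) simp
  next
    case (Suc j)
    then obtain a b where ab: "b - a \<le> q ^ j * M + 2 * \<eta>"
      "\<And>x. a \<le> ratio (j * N) \<phi> x \<and> ratio (j * N) \<phi> x \<le> b" by blast
    obtain a' b' where ab': "b' - a' \<le> q * (b - a) + c * \<eta>"
      "\<forall>x. a' \<le> ratio (N + j * N) \<phi> x \<and> ratio (N + j * N) \<phi> x \<le> b'"
      using step[OF _ ab(2)] osc unfolding q_def by blast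
    have "q * (b - a) + c * \<eta> \<le> q * (q ^ j * M + 2 * \<eta>) + c * \<eta>"
      using ab(1) q(1) by (intro add_right_mono mult_left_mono)
    also have "\<dots> = q ^ Suc j * M + 2 * \<eta>"
      by (simp add: q_def algebra_simps)
    finally show ?case using ab' by (intro exI[of _ a'] exI[of _ b']) simp
  qed
  obtain j where j: "q ^ j < \<eta> / M"
    using real_arch_pow_inv[of "\<eta> / M" q] q assms by auto
  have jM: "q ^ j * M \<le> \<eta>" using j assms(3) by (simp add: field_simps)
  show ?thesis
  proof (intro exI[of _ "j * N"] allI impI)
    fix \<phi> assume "\<forall>x. 0 \<le> \<phi> x \<and> \<phi> x \<le> M"
      "\<forall>n y z. dist y z < \<delta> \<longrightarrow> ratio n \<phi> y \<le> ratio n \<phi> z + \<eta>"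
    from iter[OF this, of j] obtain a b where ab: "b - a \<le> q ^ j * M + 2 * \<eta>"
      "\<And>x. a \<le> ratio (j * N) \<phi> x \<and> ratio (j * N) \<phi> x \<le> b" by blast
    have "b - a \<le> 3 * \<eta>" using ab(1) jM by linarith
    then show "\<exists>a b. b - a \<le> 3 * \<eta> \<and> (\<forall>k\<ge>j * N. \<forall>x. a \<le> ratio k \<phi> x \<and> ratio k \<phi> x \<le> b)"
      using ratio_bounds_mono[OF ab(2)] by blast
  qed
qed

text \<open>Numerator and denominator of a ratio each contribute one \<^term>\<open>\<theta> \<delta>\<close>.\<close>

lemma log_cont_ratio:
  assumes "\<delta> \<le> \<rho>" "log_cont \<delta> \<epsilon> \<phi>" "\<And>x. \<phi> x \<le> M" "dist y z < \<delta>"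
  shows "ratio n \<phi> y \<le> ratio n \<phi> z + M * (exp (2 * \<theta> \<delta> + \<epsilon>) - 1)"
proof -
  let ?e = "exp (2 * \<theta> \<delta> + \<epsilon>)"
  have \<phi>_pos: "0 < \<phi> x" for x using log_contD(1)[OF assms(2)] .
  note lc = Ln_log_cont[OF assms(1,2), of n]
  have d: "dist z y < \<rho>" "\<theta> (dist y z) \<le> \<theta> \<delta>"
    using assms(1,4) by (auto simp: dist_commute intro: \<theta>_le)
  have "0 \<le> \<epsilon>" 
    using log_contD(2)[OF assms(2), of y y] assms(4) \<phi>_pos[of y] \<theta>_zero
      le_less_trans[OF zero_le_dist assms(4)] by simp
  have "(L ^^ n) \<phi> y \<le> (L ^^ n) \<phi> z * exp (\<theta> (dist y z) + \<epsilon>)"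
    by (rule log_contD(2)[OF lc assms(4)])
  also have "\<dots> \<le> (L ^^ n) \<phi> z * exp (\<theta> \<delta> + \<epsilon>)"
    using log_contD(1)[OF lc, of z] d by (intro mult_left_mono) auto
  also have "\<dots> = ratio n \<phi> z * exp (\<theta> \<delta> + \<epsilon>) * iter_one n z"
    using iter_one_pos[of n z] by (simp add: ratio_def)
  also have "\<dots> \<le> ratio n \<phi> z * exp (\<theta> \<delta> + \<epsilon>) * (iter_one n y * exp (\<theta> \<delta>))"
  proof (intro mult_left_mono)
    have "iter_one n z \<le> iter_one n y * exp (\<theta> (dist z y) + 0)"
      by (rule log_contD(2)[OF iter_one_log_cont d(1)])
    also have "\<dots> \<le> iter_one n y * exp (\<theta> \<delta>)"
      using iter_one_pos[of n y] d(2) by (intro mult_left_mono) (auto simp: dist_commute)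
    finally show "iter_one n z \<le> iter_one n y * exp (\<theta> \<delta>)" .
    show "0 \<le> ratio n \<phi> z * exp (\<theta> \<delta> + \<epsilon>)"
      using log_contD(1)[OF lc, of z] iter_one_pos[of n z] by (simp add: ratio_def)
  qed
  also have "\<dots> = (ratio n \<phi> z * ?e) * iter_one n y"
  proof -
    have "?e = exp (\<theta> \<delta> + \<epsilon>) * exp (\<theta> \<delta>)"
      unfolding exp_add[symmetric] by (simp add: algebra_simps)
    then show ?thesis by (simp only: mult_ac)
  qed
  finally have "ratio n \<phi> y \<le> ratio n \<phi> z * ?e" by (simp add: ratio_le_iff)
  also have "\<dots> = ratio n \<phi> z + ratio n \<phi> z * (?e - 1)" by (simp add: algebra_simps)
  also have "\<dots> \<le> ratio n \<phi> z + M * (?e - 1)"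
  proof -
    have "ratio n \<phi> z \<le> M"
      using ratio_bounds_mono[of 0 0 \<phi> M n z] assms(3) \<phi>_pos by (simp add: less_imp_le)
    moreover have "0 \<le> \<theta> \<delta>" using assms(4) by (intro \<theta>_nonneg) (metis zero_le_dist le_less_trans less_imp_le)
    ultimately show ?thesis using \<open>0 \<le> \<epsilon>\<close> by (intro add_left_mono mult_right_mono) auto
  qed
  finally show ?thesis .
qed

lemma small_slack:
  assumes "0 < \<eta>" "0 < M"
  obtains \<epsilon> \<delta> where "0 < \<epsilon>" "0 < \<delta>" "\<delta> \<le> \<rho>" "M * (exp (2 * \<theta> \<delta> + \<epsilon>) - 1) \<le> \<eta>"
proof -
  define \<epsilon> where "\<epsilon> = ln (1 + \<eta> / M) / 3"
  have pos: "0 < \<eta> / M" using assms by simp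
  then have \<epsilon>: "0 < \<epsilon>" by (simp add: \<epsilon>_def ln_gt_zero)
  obtain d where d: "d > 0" "\<theta> d < \<epsilon>" using \<theta>_small[OF \<epsilon>] by blast
  show thesis
  proof (rule that[OF \<epsilon>, of "min d \<rho>"])
    have "\<theta> (min d \<rho>) \<le> \<theta> d" using d(1) \<rho>_pos by (intro \<theta>_le) auto
    then have "2 * \<theta> (min d \<rho>) + \<epsilon> \<le> ln (1 + \<eta> / M)" using d(2) by (simp add: \<epsilon>_def)
    then have "exp (2 * \<theta> (min d \<rho>) + \<epsilon>) \<le> exp (ln (1 + \<eta> / M))" by (simp only: exp_le_cancel_iff)
    also have "\<dots> = 1 + \<eta> / M" using pos by simp
    finally have "M * (exp (2 * \<theta> (min d \<rho>) + \<epsilon>) - 1) \<le> M * (\<eta> / M)"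
      using assms(2) by (intro mult_left_mono) auto
    then show "M * (exp (2 * \<theta> (min d \<rho>) + \<epsilon>) - 1) \<le> \<eta>" using assms(2) by simp
  qed (use d \<rho>_pos in auto)
qed

lemma ratio_limit_pos:
  assumes "continuous_on UNIV \<phi>" "\<And>x. 0 < \<phi> x"
  shows "\<exists>l. uniform_limit UNIV (\<lambda>n. ratio n \<phi>) (\<lambda>_. l) sequentially"
proof -
  obtain M where M: "0 < M" "\<And>x. \<bar>\<phi> x\<bar> < M" using continuous_bounded[OF assms(1)] by blast
  have close: "\<exists>k0. \<forall>m\<ge>k0. \<forall>n\<ge>k0. \<forall>x y. \<bar>ratio m \<phi> x - ratio n \<phi> y\<bar> < e" if "0 < e" for e
  proof -
    define \<eta> where "\<eta> = e / 4"
    have \<eta>: "0 < \<eta>" using that by (simp add: \<eta>_def)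
    obtain \<epsilon> \<delta>1 where \<epsilon>: "0 < \<epsilon>" "0 < \<delta>1" "\<delta>1 \<le> \<rho>" "M * (exp (2 * \<theta> \<delta>1 + \<epsilon>) - 1) \<le> \<eta>"
      using small_slack[OF \<eta> M(1)] by blast
    obtain \<delta>2 where \<delta>2: "0 < \<delta>2" "\<delta>2 \<le> \<rho>" "log_cont \<delta>2 \<epsilon> \<phi>"
      using continuous_imp_log_cont[OF assms \<epsilon>(1)] by blast
    define \<delta> where "\<delta> = min \<delta>1 \<delta>2"
    have \<delta>: "0 < \<delta>" "\<delta> \<le> \<rho>" "log_cont \<delta> \<epsilon> \<phi>" "\<theta> \<delta> \<le> \<theta> \<delta>1"
      using \<epsilon> \<delta>2 by (auto simp: \<delta>_def log_cont_def intro: \<theta>_le)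
    have osc: "ratio n \<phi> y \<le> ratio n \<phi> z + \<eta>" if "dist y z < \<delta>" for n y z
    proof -
      have "ratio n \<phi> y \<le> ratio n \<phi> z + M * (exp (2 * \<theta> \<delta> + \<epsilon>) - 1)"
        by (rule log_cont_ratio[OF \<delta>(2,3) _ that]) (use M(2) in \<open>auto simp: abs_less_iff intro: less_imp_le\<close>)
      also have "M * (exp (2 * \<theta> \<delta> + \<epsilon>) - 1) \<le> M * (exp (2 * \<theta> \<delta>1 + \<epsilon>) - 1)"
        using \<delta>(4) M(1) by (intro mult_left_mono) auto
      finally show ?thesis using \<epsilon>(4) by linarith
    qed
    have "\<forall>x. 0 \<le> \<phi> x \<and> \<phi> x \<le> M"
      using assms(2) M(2) by (auto simp: abs_less_iff intro: less_imp_le)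
    then obtain k0 a b where k0: "b - a \<le> 3 * \<eta>" "\<forall>k\<ge>k0. \<forall>x. a \<le> ratio k \<phi> x \<and> ratio k \<phi> x \<le> b"
      using ratio_contract[OF \<delta>(1) \<eta> M(1)] osc by metis
    show ?thesis
    proof (intro exI[of _ k0] allI impI)
      fix m n x y assume "k0 \<le> m" "k0 \<le> n"
      then have "a \<le> ratio m \<phi> x" "ratio m \<phi> x \<le> b" "a \<le> ratio n \<phi> y" "ratio n \<phi> y \<le> b"
        using k0(2) by auto
      then show "\<bar>ratio m \<phi> x - ratio n \<phi> y\<bar> < e"
        using k0(1) that by (auto simp: \<eta>_def abs_less_iff)
    qed
  qed
  have "Cauchy (\<lambda>n. ratio n \<phi> (Circle 0))"
    unfolding Cauchy_altdef2 dist_real_def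
    using close by (metis order_refl)
  then obtain l where l: "(\<lambda>n. ratio n \<phi> (Circle 0)) \<longlonglongrightarrow> l"
    using Cauchy_convergent convergent_def by blast
  have "uniform_limit UNIV (\<lambda>n. ratio n \<phi>) (\<lambda>_. l) sequentially"
    unfolding uniform_limit_sequentially_iff
  proof (intro allI impI)
    fix e :: real assume "0 < e"
    then obtain k0 where k0: "\<forall>m\<ge>k0. \<forall>n\<ge>k0. \<forall>x y. \<bar>ratio m \<phi> x - ratio n \<phi> y\<bar> < e / 2"
      using close[OF half_gt_zero] by blast
    have le: "\<bar>ratio m \<phi> x - l\<bar> \<le> e / 2" if "m \<ge> k0" for m x
    proof (rule LIMSEQ_le_const2)
      show "(\<lambda>n. \<bar>ratio m \<phi> x - ratio n \<phi> (Circle 0)\<bar>) \<longlonglongrightarrow> \<bar>ratio m \<phi> x - l\<bar>"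
        by (intro tendsto_intros l)
      show "\<exists>N. \<forall>n\<ge>N. \<bar>ratio m \<phi> x - ratio n \<phi> (Circle 0)\<bar> \<le> e / 2"
        using k0 that by (meson less_imp_le)
    qed
    have "dist (ratio m \<phi> x) l < e" if "m \<ge> k0" for m x
      using le[OF that, of x] \<open>0 < e\<close> unfolding dist_real_def by linarith
    then show "\<exists>N. \<forall>n\<ge>N. \<forall>x\<in>UNIV. dist (ratio n \<phi> x) l < e"
      by blast
  qed
  then show ?thesis by blast
qed

lemma ratio_limit:
  assumes "continuous_on UNIV \<phi>"
  shows "\<exists>l. uniform_limit UNIV (\<lambda>n. ratio n \<phi>) (\<lambda>_. l) sequentially"
proof -
  obtain M where M: "0 < M" "\<And>x. \<bar>\<phi> x\<bar> < M" using continuous_bounded[OF assms] by blast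
  have "0 < \<phi> x + M" for x using M(2)[of x] by linarith
  then obtain l where l: "uniform_limit UNIV (\<lambda>n. ratio n (\<lambda>x. \<phi> x + M)) (\<lambda>_. l) sequentially"
    using ratio_limit_pos[OF continuous_on_add[OF assms continuous_on_const]] by blast
  have "ratio n (\<lambda>x. \<phi> x + M) x - M = ratio n \<phi> x" for n x
    using Ln_lin[of n 1 \<phi> M "\<lambda>_. 1"] iter_one_pos[of n x]
    by (simp add: ratio_def iter_one_def[symmetric] field_simps)
  moreover have "uniform_limit UNIV (\<lambda>n x. ratio n (\<lambda>x. \<phi> x + M) x - M) (\<lambda>_. l - M) sequentially"
    by (intro uniform_limit_minus l uniform_limit_const)
  ultimately show ?thesis by auto
qed

end

section \<open>The eigenmeasure\<close>

context branching_operator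
begin

text \<open>The image of a Dirac measure under the dual of \<open>L\<^sup>n\<close> is a finite discrete measure.\<close>

lemma Ln_as_weighted_sum:
  "\<exists>A w. finite A \<and> (\<forall>y\<in>A. 0 \<le> w y) \<and> (\<forall>\<phi>. (L ^^ n) \<phi> x = (\<Sum>y\<in>A. w y * \<phi> y))"
proof (induction n)
  case 0
  show ?case by (intro exI[of _ "{x}"] exI[of _ "\<lambda>_. 1"]) simp
next
  case (Suc n)
  then obtain A w where A: "finite A" "\<forall>y\<in>A. 0 \<le> w y"
    "\<And>\<phi>. (L ^^ n) \<phi> x = (\<Sum>y\<in>A. w y * \<phi> y)" by blast
  have "(L ^^ Suc n) \<phi> x = (\<Sum>z\<in>(\<Union>y\<in>A. T -` {y}). w (T z) * exp (f z) * \<phi> z)" for \<phi>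
  proof -
    have "(L ^^ Suc n) \<phi> x = (\<Sum>y\<in>A. w y * L \<phi> y)"
      by (simp only: funpow_Suc_right o_apply A(3))
    also have "\<dots> = (\<Sum>y\<in>A. \<Sum>z\<in>T -` {y}. w (T z) * exp (f z) * \<phi> z)"
      unfolding L_eq sum_distrib_left by (intro sum.cong refl) auto
    also have "\<dots> = (\<Sum>z\<in>(\<Union>y\<in>A. T -` {y}). w (T z) * exp (f z) * \<phi> z)"
      using A(1) finite_fib by (intro sum.UNION_disjoint[symmetric]) auto
    finally show ?thesis .
  qed
  then show ?case
    using A(1,2) finite_fib
    by (intro exI[of _ "\<Union>y\<in>A. T -` {y}"] exI[of _ "\<lambda>z. w (T z) * exp (f z)"]) auto
qed

text \<open>The limits of the ratios form a normalised positive functional on the continuous functions.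
  It is the limit of the discrete probability measures given by the normalised iterates of a Dirac
  measure under the dual operator. Read on the line through \<^term>\<open>coord\<close>, these measures live on
  the unit interval, so Helly's selection theorem provides a limit measure that represents
  the functional.\<close>

lemma ratio_limit_measure:
  obtains \<nu> :: "circle measure" where "prob_space \<nu>" "sets \<nu> = sets borel"
    "\<And>\<phi>. continuous_on UNIV \<phi> \<Longrightarrow>
       uniform_limit UNIV (\<lambda>n. ratio n \<phi>) (\<lambda>_. \<integral>y. \<phi> y \<partial>\<nu>) sequentially"
proof -
  define x0 where "x0 = Circle 0"
  obtain A w where A: "\<And>n. finite (A n)" "\<And>n y. y \<in> A n \<Longrightarrow> 0 \<le> w n y"
    "\<And>n \<phi>. (L ^^ n) \<phi> x0 = (\<Sum>y\<in>A n. w n y * \<phi> y)"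
    using Ln_as_weighted_sum[of _ x0] by metis
  define W where "W n y = w n y / iter_one n x0" for n y
  have W_nonneg: "0 \<le> W n y" if "y \<in> A n" for n y
    using A(2)[OF that] iter_one_pos[of n x0] by (simp add: W_def)
  have W_sum: "(\<Sum>y\<in>A n. W n y * \<phi> y) = ratio n \<phi> x0" for n \<phi>
    by (simp add: W_def ratio_def A(3) sum_divide_distrib)
  have W_one: "(\<Sum>y\<in>A n. W n y) = 1" for n
    using W_sum[of n "\<lambda>_. 1"] iter_one_pos[of n x0] by (simp add: ratio_def iter_one_def)
  define P where "P n = point_measure (A n) (\<lambda>y. ennreal (W n y))" for n
  define \<mu> where "\<mu> n = distr (P n) borel coord" for n
  have P_prob: "prob_space (P n)" for n
    unfolding P_def by (intro prob_space_point_measure A W_nonneg) (simp_all add: W_one W_nonneg sum_ennreal)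
  have meas: "coord \<in> borel_measurable (P n)" for n
    by (simp add: P_def)
  have \<mu>_dist: "real_distribution (\<mu> n)" for n
    unfolding \<mu>_def by (rule prob_space.real_distribution_distr[OF P_prob meas])
  have \<mu>_int: "(\<integral>t. g t \<partial>\<mu> n) = ratio n (\<lambda>y. g (coord y)) x0"
    if "g \<in> borel_measurable borel" for n and g :: "real \<Rightarrow> real"
  proof -
    have "(\<integral>t. g t \<partial>\<mu> n) = (\<integral>y. g (coord y) \<partial>P n)"
      unfolding \<mu>_def by (rule integral_distr[OF meas that])
    also have "\<dots> = (\<Sum>y\<in>A n. W n y * g (coord y))"
      unfolding P_def using A(1) W_nonneg by (subst lebesgue_integral_point_measure_finite) auto
    finally show ?thesis by (simp add: W_sum)
  qed
  have "measure (\<mu> n) {-1<..1} = 1" for n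
  proof -
    have "coord y \<in> {-1<..1}" for y using coord_bounds[of y] by simp
    then have "coord -` {-1<..1} \<inter> space (P n) = space (P n)" by blast
    then show ?thesis
      unfolding \<mu>_def using prob_space.prob_space[OF P_prob]
      by (subst measure_distr[OF meas]) auto
  qed
  then have "\<forall>n. 1 - e < measure (\<mu> n) {-1<..1}" if "0 < e" for e
    using that by simp
  moreover have "(-1::real) < 1" by simp
  ultimately have "tight \<mu>"
    unfolding tight_def using \<mu>_dist by blast
  from tight_imp_convergent_subsubsequence[OF this strict_mono_id]
  obtain r M where r: "strict_mono r" and M: "real_distribution M" and
    conv: "weak_conv_m (\<mu> \<circ> id \<circ> r) M" by blast
  interpret M: real_distribution M by (rule M)
  have proj_meas: "proj \<in> measurable M borel"
  proof -
    have "proj \<in> borel_measurable borel"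
      by (rule borel_measurable_continuous_onI[OF continuous_on_proj])
    then show ?thesis by simp
  qed
  define \<nu> where "\<nu> = distr M borel proj"
  show thesis
  proof (rule that[of \<nu>])
    show "prob_space \<nu>" unfolding \<nu>_def by (rule M.prob_space_distr[OF proj_meas])
    show "sets \<nu> = sets borel" by (simp add: \<nu>_def)
    fix \<phi> :: "circle \<Rightarrow> real" assume \<phi>: "continuous_on UNIV \<phi>"
    obtain l where l: "uniform_limit UNIV (\<lambda>n. ratio n \<phi>) (\<lambda>_. l) sequentially"
      using ratio_limit[OF \<phi>] by blast
    obtain K where K: "\<And>x. \<bar>\<phi> x\<bar> < K" using continuous_bounded[OF \<phi>] by blast
    have cont: "continuous_on UNIV (\<lambda>t. \<phi> (proj t))"
      by (rule continuous_on_compose2[OF \<phi> continuous_on_proj]) auto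
    have "(\<lambda>n. \<integral>t. \<phi> (proj t) \<partial>(\<mu> \<circ> id \<circ> r) n) \<longlonglongrightarrow> (\<integral>t. \<phi> (proj t) \<partial>M)"
    proof (rule weak_conv_imp_integral_bdd_continuous_conv[OF _ M conv])
      show "isCont (\<lambda>t. \<phi> (proj t)) t" for t
        using cont by (simp add: continuous_on_eq_continuous_at)
      show "norm (\<phi> (proj t)) \<le> K" for t
        using K[of "proj t"] by simp
    qed (simp_all add: \<mu>_dist)
    moreover have "(\<integral>t. \<phi> (proj t) \<partial>(\<mu> \<circ> id \<circ> r) n) = ratio (r n) \<phi> x0" for n
      using \<mu>_int[OF borel_measurable_continuous_onI[OF cont]] by simp
    moreover have "(\<integral>t. \<phi> (proj t) \<partial>M) = (\<integral>y. \<phi> y \<partial>\<nu>)"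
      unfolding \<nu>_def
      by (rule integral_distr[symmetric, OF proj_meas borel_measurable_continuous_onI[OF \<phi>]])
    ultimately have "(\<lambda>n. ratio (r n) \<phi> x0) \<longlonglongrightarrow> (\<integral>y. \<phi> y \<partial>\<nu>)" by simp
    moreover have "(\<lambda>n. ratio (r n) \<phi> x0) \<longlonglongrightarrow> l"
      using LIMSEQ_subseq_LIMSEQ[OF tendsto_uniform_limitI[OF l UNIV_I] r] by (simp add: o_def)
    ultimately have "l = (\<integral>y. \<phi> y \<partial>\<nu>)" using LIMSEQ_unique by blast
    then show "uniform_limit UNIV (\<lambda>n. ratio n \<phi>) (\<lambda>_. \<integral>y. \<phi> y \<partial>\<nu>) sequentially"
      using l by simp
  qed
qed

end

section \<open>The eigenfunction\<close>

text \<open>A measure of this kind is provided by \<open>ratio_limit_measure\<close>.\<close>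

locale ratio_measure = branching_operator +
  fixes \<nu> :: "circle measure"
  assumes prob_\<nu>: "prob_space \<nu>" and sets_\<nu>: "sets \<nu> = sets borel"
    and lim_\<nu>: "\<And>\<phi>. continuous_on UNIV \<phi> \<Longrightarrow>
       uniform_limit UNIV (\<lambda>n. ratio n \<phi>) (\<lambda>_. \<integral>y. \<phi> y \<partial>\<nu>) sequentially"
begin

definition chi :: real where
  "chi = (\<integral>y. iter_one 1 y \<partial>\<nu>)"

definition norm_iter :: "nat \<Rightarrow> circle \<Rightarrow> real" where
  "norm_iter n x = iter_one n x / chi ^ n"

lemma integrable_continuous:
  assumes "continuous_on UNIV (\<phi> :: circle \<Rightarrow> real)"
  shows "integrable \<nu> \<phi>"
proof -
  obtain M where "\<And>x. \<bar>\<phi> x\<bar> < M" using continuous_bounded[OF assms] by blast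
  then show ?thesis
    using prob_\<nu> borel_measurable_continuous_onI[OF assms] sets_\<nu>
    by (intro finite_measure.integrable_const_bound[of \<nu> \<phi> M])
      (auto simp: prob_space_def less_imp_le cong: measurable_cong_sets)
qed

lemma ratio_lim_\<nu>: "continuous_on UNIV \<phi> \<Longrightarrow> (\<lambda>n. ratio n \<phi> x) \<longlonglongrightarrow> (\<integral>y. \<phi> y \<partial>\<nu>)"
  using tendsto_uniform_limitI[OF lim_\<nu> UNIV_I] by blast

text \<open>In the factorisation \<open>ratio k (L \<phi>) = ratio (k + 1) \<phi> \<cdot> ratio k (L 1)\<close> both factors converge:
  to the integral of \<^term>\<open>\<phi>\<close> and to \<^term>\<open>chi\<close>.\<close>

lemma integral_L:
  assumes "continuous_on UNIV \<phi>"
  shows "(\<integral>y. L \<phi> y \<partial>\<nu>) = chi * (\<integral>y. \<phi> y \<partial>\<nu>)"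
proof -
  let ?x = "Circle 0"
  have "ratio k (L \<phi>) x = ratio (Suc k) \<phi> x * ratio k (iter_one 1) x" for k x
    using iter_one_pos[of k x] iter_one_pos[of "Suc k" x]
    by (simp add: ratio_def Ln_iter_one funpow_Suc_right del: funpow.simps)
  moreover have "(\<lambda>k. ratio (Suc k) \<phi> ?x * ratio k (iter_one 1) ?x) \<longlonglongrightarrow> (\<integral>y. \<phi> y \<partial>\<nu>) * chi"
    unfolding chi_def
    by (intro tendsto_mult ratio_lim_\<nu> iter_one_continuous LIMSEQ_Suc assms)
  ultimately have "(\<lambda>k. ratio k (L \<phi>) ?x) \<longlonglongrightarrow> (\<integral>y. \<phi> y \<partial>\<nu>) * chi" by simp
  moreover have "(\<lambda>k. ratio k (L \<phi>) ?x) \<longlonglongrightarrow> (\<integral>y. L \<phi> y \<partial>\<nu>)"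
    using Ln_continuous[OF assms, of 1] by (intro ratio_lim_\<nu>) simp
  ultimately show ?thesis using LIMSEQ_unique by (metis mult.commute)
qed

lemma integral_Ln:
  assumes "continuous_on UNIV \<phi>"
  shows "(\<integral>y. (L ^^ n) \<phi> y \<partial>\<nu>) = chi ^ n * (\<integral>y. \<phi> y \<partial>\<nu>)"
  by (induction n) (simp_all add: integral_L Ln_continuous assms)

lemma chi_pos: "0 < chi"
proof -
  obtain D where D: "1 \<le> D" "\<And>\<phi> p q. log_cont \<rho> 0 \<phi> \<Longrightarrow> \<phi> p \<le> D * \<phi> q"
    using distortion by blast
  have "iter_one 1 (Circle 0) / D \<le> chi"
    unfolding chi_def
    using D(1) D(2)[OF iter_one_log_cont, of 1 "Circle 0"]
    by (intro prob_space.integral_ge_const[OF prob_\<nu>] integrable_continuous iter_one_continuous)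
      (auto simp: field_simps)
  moreover have "0 < iter_one 1 (Circle 0) / D" using iter_one_pos[of 1] D(1) by simp
  ultimately show ?thesis by linarith
qed

lemma integral_norm_iter: "(\<integral>y. norm_iter n y \<partial>\<nu>) = 1"
  using integral_Ln[of "\<lambda>_. 1" n] chi_pos
  by (simp add: norm_iter_def iter_one_def prob_space.prob_space[OF prob_\<nu>])

lemma norm_iter_continuous: "continuous_on UNIV (norm_iter n)"
  unfolding norm_iter_def using chi_pos by (intro continuous_intros iter_one_continuous) simp

lemma norm_iter_log_cont: "log_cont \<rho> 0 (norm_iter n)"
  unfolding log_cont_def
proof (intro conjI allI impI)
  show "0 < norm_iter n x" for x using iter_one_pos[of n x] chi_pos by (simp add: norm_iter_def)
  fix p q :: circle assume "dist p q < \<rho>"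
  then have "iter_one n p / chi ^ n \<le> iter_one n q * exp (\<theta> (dist p q) + 0) / chi ^ n"
    using chi_pos by (intro divide_right_mono log_contD(2)[OF iter_one_log_cont]) auto
  then show "norm_iter n p \<le> norm_iter n q * exp (\<theta> (dist p q) + 0)" by (simp add: norm_iter_def)
qed

lemma norm_iter_bounds:
  obtains D where "1 \<le> D" "\<And>n x. 1 / D \<le> norm_iter n x" "\<And>n x. norm_iter n x \<le> D"
proof -
  obtain D where D: "1 \<le> D" "\<And>\<phi> p q. log_cont \<rho> 0 \<phi> \<Longrightarrow> \<phi> p \<le> D * \<phi> q"
    using distortion by blast
  show thesis
  proof (rule that[OF D(1)])
    fix n x
    have "norm_iter n x / D \<le> (\<integral>y. norm_iter n y \<partial>\<nu>)"
      using D(1) D(2)[OF norm_iter_log_cont, of n x]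
      by (intro prob_space.integral_ge_const[OF prob_\<nu>] integrable_continuous norm_iter_continuous)
        (auto simp: field_simps)
    then show "norm_iter n x \<le> D" using D(1) by (simp add: integral_norm_iter field_simps)
    have "(\<integral>y. norm_iter n y \<partial>\<nu>) \<le> D * norm_iter n x"
      using D(1) D(2)[OF norm_iter_log_cont, of n _ x]
      by (intro prob_space.integral_le_const[OF prob_\<nu>] integrable_continuous norm_iter_continuous) auto
    then show "1 / D \<le> norm_iter n x" using D(1) by (simp add: integral_norm_iter field_simps)
  qed
qed

text \<open>All functions \<^term>\<open>norm_iter m\<close> obey one bound and one modulus, so the ratios contract for
  all of them simultaneously. Since every \<^term>\<open>norm_iter m\<close> has integral 1, the limit of the
  ratios is 1, and this compares \<^term>\<open>norm_iter (m + k)\<close> with \<^term>\<open>norm_iter k\<close> uniformly in \<^term>\<open>m\<close>.\<close>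

lemma norm_iter_Cauchy:
  assumes "0 < e"
  shows "\<exists>k0. \<forall>k\<ge>k0. \<forall>m x. \<bar>norm_iter (m + k) x - norm_iter k x\<bar> < e"
proof -
  obtain D where D: "1 \<le> D" "\<And>n x. 1 / D \<le> norm_iter n x" "\<And>n x. norm_iter n x \<le> D"
    by (rule norm_iter_bounds) blast
  define \<eta> where "\<eta> = e / (4 * D)"
  have \<eta>: "0 < \<eta>" using assms D(1) by (simp add: \<eta>_def)
  obtain \<epsilon> \<delta> where \<epsilon>: "0 < \<epsilon>" "0 < \<delta>" "\<delta> \<le> \<rho>" "D * (exp (2 * \<theta> \<delta> + \<epsilon>) - 1) \<le> \<eta>"
    using small_slack[OF \<eta>, of D] D(1) by auto
  obtain k0 where k0: "\<And>\<phi>. (\<forall>x. 0 \<le> \<phi> x \<and> \<phi> x \<le> D) \<Longrightarrow>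
      (\<forall>n y z. dist y z < \<delta> \<longrightarrow> ratio n \<phi> y \<le> ratio n \<phi> z + \<eta>) \<Longrightarrow>
      \<exists>a b. b - a \<le> 3 * \<eta> \<and> (\<forall>k\<ge>k0. \<forall>x. a \<le> ratio k \<phi> x \<and> ratio k \<phi> x \<le> b)"
    using ratio_contract[OF \<epsilon>(2) \<eta>, of D] D(1) by auto
  have norm_iter_pos: "0 < norm_iter m x" for m x by (rule log_contD(1)[OF norm_iter_log_cont])
  have "\<bar>norm_iter (m + k) x - norm_iter k x\<bar> < e" if "k0 \<le> k" for m k x
  proof -
    have lc: "log_cont \<delta> 0 (norm_iter m)"
      using norm_iter_log_cont[of m] \<epsilon>(3) by (auto simp: log_cont_def)
    have osc: "ratio n (norm_iter m) y \<le> ratio n (norm_iter m) z + \<eta>" if "dist y z < \<delta>" for n y z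
    proof -
      have "ratio n (norm_iter m) y \<le> ratio n (norm_iter m) z + D * (exp (2 * \<theta> \<delta> + 0) - 1)"
        by (rule log_cont_ratio[OF \<epsilon>(3) lc D(3) that])
      also have "D * (exp (2 * \<theta> \<delta> + 0) - 1) \<le> D * (exp (2 * \<theta> \<delta> + \<epsilon>) - 1)"
        using \<epsilon>(1) D(1) by (intro mult_left_mono) auto
      finally show ?thesis using \<epsilon>(4) by linarith
    qed
    have "\<forall>x. 0 \<le> norm_iter m x \<and> norm_iter m x \<le> D"
      using norm_iter_pos D(3) by (simp add: less_imp_le)
    from k0[OF this] osc obtain a b where "b - a \<le> 3 * \<eta>"
      "\<forall>k\<ge>k0. \<forall>x. a \<le> ratio k (norm_iter m) x \<and> ratio k (norm_iter m) x \<le> b" by blast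
    then have ab: "b - a \<le> 3 * \<eta>" "\<And>x. a \<le> ratio k (norm_iter m) x" "\<And>x. ratio k (norm_iter m) x \<le> b"
      using that by blast+
    have ratio_norm_iter: "ratio k (norm_iter m) x = norm_iter (m + k) x / norm_iter k x" for x
    proof -
      have "norm_iter m = (\<lambda>x. (1 / chi ^ m) * iter_one m x)" by (auto simp: norm_iter_def)
      then have "(L ^^ k) (norm_iter m) x = (1 / chi ^ m) * iter_one (k + m) x"
        by (simp only: Ln_cmult Ln_iter_one)
      then have "ratio k (norm_iter m) x = (1 / chi ^ m) * iter_one (k + m) x / iter_one k x"
        by (simp only: ratio_def)
      then show ?thesis using chi_pos
        by (simp add: norm_iter_def power_add add.commute mult.commute)
    qed
    have bd: "a * norm_iter k x \<le> norm_iter (m + k) x" "norm_iter (m + k) x \<le> b * norm_iter k x" for x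
      using ab(2,3)[of x] norm_iter_pos[of k x] by (simp_all add: ratio_norm_iter field_simps)
    have "(\<integral>x. a * norm_iter k x \<partial>\<nu>) \<le> (\<integral>x. norm_iter (m + k) x \<partial>\<nu>)"
      by (intro integral_mono integrable_continuous continuous_intros norm_iter_continuous bd)
    moreover have "(\<integral>x. norm_iter (m + k) x \<partial>\<nu>) \<le> (\<integral>x. b * norm_iter k x \<partial>\<nu>)"
      by (intro integral_mono integrable_continuous continuous_intros norm_iter_continuous bd)
    ultimately have "a \<le> 1" "1 \<le> b" by (simp_all add: integral_norm_iter)
    then have "b \<le> 1 + 3 * \<eta>" "1 - 3 * \<eta> \<le> a" using ab(1) by linarith+
    then have "b * norm_iter k x \<le> (1 + 3 * \<eta>) * norm_iter k x" "(1 - 3 * \<eta>) * norm_iter k x \<le> a * norm_iter k x"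
      using norm_iter_pos[of k x] by (auto intro!: mult_right_mono)
    then have "\<bar>norm_iter (m + k) x - norm_iter k x\<bar> \<le> 3 * \<eta> * norm_iter k x"
      using bd[of x] by (auto simp: algebra_simps abs_le_iff)
    also have "\<dots> \<le> 3 * \<eta> * D" using \<eta> D(3) by (intro mult_left_mono) auto
    also have "\<dots> < e" using assms D(1) by (simp add: \<eta>_def)
    finally show ?thesis .
  qed
  then show ?thesis by blast
qed

lemma eigenfunction:
  obtains h where "log_cont \<rho> 0 h" "L h = (\<lambda>x. chi * h x)" "(\<integral>x. h x \<partial>\<nu>) = 1"
    "\<And>\<phi>. continuous_on UNIV \<phi> \<Longrightarrow>
      uniform_limit UNIV (\<lambda>n x. (L ^^ n) \<phi> x / chi ^ n) (\<lambda>x. h x * (\<integral>y. \<phi> y \<partial>\<nu>)) sequentially"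
proof -
  obtain D where D: "1 \<le> D" "\<And>n x. 1 / D \<le> norm_iter n x" "\<And>n x. norm_iter n x \<le> D"
    by (rule norm_iter_bounds) blast
  have "uniformly_convergent_on UNIV norm_iter"
  proof (intro Cauchy_uniformly_convergent uniformly_Cauchy_onI')
    fix e :: real assume "0 < e"
    then obtain k0 where k0: "\<And>k m x. k \<ge> k0 \<Longrightarrow> \<bar>norm_iter (m + k) x - norm_iter k x\<bar> < e"
      using norm_iter_Cauchy by blast
    have "dist (norm_iter m x) (norm_iter n x) < e" if "k0 \<le> m" "m < n" for m n x
      using k0[OF that(1), of "n - m" x] that(2) by (simp add: dist_real_def abs_minus_commute)
    then show "\<exists>M. \<forall>x\<in>UNIV. \<forall>m\<ge>M. \<forall>n>m. dist (norm_iter m x) (norm_iter n x) < e" by blast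
  qed
  then obtain h where h: "uniform_limit UNIV norm_iter h sequentially"
    unfolding uniformly_convergent_on_def by blast
  have hx: "(\<lambda>n. norm_iter n x) \<longlonglongrightarrow> h x" for x
    by (rule tendsto_uniform_limitI[OF h UNIV_I])
  have h_pos: "0 < h x" for x
  proof -
    have "1 / D \<le> h x" using D(2) by (intro LIMSEQ_le_const[OF hx]) auto
    moreover have "0 < 1 / D" using D(1) by simp
    ultimately show ?thesis by linarith
  qed
  have h_log: "log_cont \<rho> 0 h"
    unfolding log_cont_def
  proof (intro conjI allI impI h_pos)
    fix p q :: circle assume d: "dist p q < \<rho>"
    have "(\<lambda>n. norm_iter n q * exp (\<theta> (dist p q) + 0)) \<longlonglongrightarrow> h q * exp (\<theta> (dist p q) + 0)"
      by (intro tendsto_intros hx)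
    then show "h p \<le> h q * exp (\<theta> (dist p q) + 0)"
      by (rule LIMSEQ_le[OF hx]) (use log_contD(2)[OF norm_iter_log_cont d] in auto)
  qed
  have L_norm_iter: "L (norm_iter n) x = chi * norm_iter (Suc n) x" for n x
  proof -
    have "norm_iter n = (\<lambda>x. (1 / chi ^ n) * iter_one n x)" by (auto simp: norm_iter_def)
    then have "L (norm_iter n) x = (1 / chi ^ n) * iter_one (Suc n) x"
      using Ln_cmult[of 1 "1 / chi ^ n" "iter_one n"] Ln_iter_one[of 1 n] by simp
    then show ?thesis using chi_pos by (simp add: norm_iter_def)
  qed
  have h_eig: "L h = (\<lambda>x. chi * h x)"
  proof
    fix x
    have "(\<lambda>n. L (norm_iter n) x) \<longlonglongrightarrow> L h x"
      unfolding L_eq by (intro tendsto_intros hx)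
    moreover have "(\<lambda>n. L (norm_iter n) x) \<longlonglongrightarrow> chi * h x"
      unfolding L_norm_iter by (intro tendsto_intros LIMSEQ_Suc hx)
    ultimately show "L h x = chi * h x" using LIMSEQ_unique by blast
  qed
  have h_cont: "continuous_on UNIV h"
    by (rule uniform_limit_theorem[OF _ h]) (auto intro!: always_eventually norm_iter_continuous)
  have Ln_h: "(L ^^ n) h = (\<lambda>x. chi ^ n * h x)" for n
  proof (induction n)
    case (Suc n)
    then show ?case using Ln_cmult[of 1 "chi ^ n" h] by (simp add: h_eig mult_ac)
  qed simp
  \<comment> \<open>The ratio of the eigenfunction is \<open>h / (\<chi>\<^sup>-\<^sup>n L\<^sup>n 1)\<close>, whose limit is \<open>h / h\<close> on the one hand and the
     integral on the other.\<close>
  have "(\<integral>x. h x \<partial>\<nu>) = 1"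
  proof -
    let ?x = "Circle 0"
    have "ratio n h ?x = h ?x / norm_iter n ?x" for n
      using chi_pos iter_one_pos[of n ?x] by (simp add: ratio_def norm_iter_def Ln_h)
    moreover have "(\<lambda>n. h ?x / norm_iter n ?x) \<longlonglongrightarrow> h ?x / h ?x"
      using h_pos[of ?x] by (intro tendsto_intros hx) simp
    ultimately have "(\<lambda>n. ratio n h ?x) \<longlonglongrightarrow> 1" using h_pos[of ?x] by simp
    then show ?thesis using ratio_lim_\<nu>[OF h_cont, of ?x] LIMSEQ_unique by blast
  qed
  moreover have "uniform_limit UNIV (\<lambda>n x. (L ^^ n) \<phi> x / chi ^ n)
      (\<lambda>x. h x * (\<integral>y. \<phi> y \<partial>\<nu>)) sequentially" if \<phi>: "continuous_on UNIV \<phi>" for \<phi>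
  proof -
    have "(L ^^ n) \<phi> x / chi ^ n = norm_iter n x * ratio n \<phi> x" for n x
      using iter_one_pos[of n x] by (simp add: norm_iter_def ratio_def)
    moreover obtain K where "\<And>x. \<bar>h x\<bar> < K" using continuous_bounded[OF h_cont] by blast
    then have "bounded (range h)" by (auto simp: bounded_iff intro!: exI[of _ K] less_imp_le)
    then have "uniform_limit UNIV (\<lambda>n x. norm_iter n x * ratio n \<phi> x)
        (\<lambda>x. h x * (\<integral>y. \<phi> y \<partial>\<nu>)) sequentially"
      by (intro uniform_lim_mult h lim_\<nu> \<phi>) auto
    ultimately show ?thesis by simp
  qed
  ultimately show thesis using that h_log h_eig by blast
qed

end

section \<open>Spectral consequences of the convergence\<close>

text \<open>On the generalised eigenspace the defect \<open>L \<psi> - \<kappa> \<psi>\<close> of a vector of height two is an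
  eigenfunction, hence a multiple of \<^term>\<open>h\<close> by the convergence, and its integral vanishes by
  the eigenmeasure equation. Thus there are no Jordan blocks.\<close>

lemma simple_eigenvalue_of_convergence:
  fixes L :: "(circle \<Rightarrow> real) \<Rightarrow> circle \<Rightarrow> real" and \<nu> :: "circle measure"
  assumes lin: "\<And>a b \<phi> \<psi>. L (\<lambda>x. a * \<phi> x + b * \<psi> x) = (\<lambda>x. a * L \<phi> x + b * L \<psi> x)"
    and cont: "\<And>\<phi>. continuous_on UNIV \<phi> \<Longrightarrow> continuous_on UNIV (L \<phi>)"
    and integrable: "\<And>\<phi> :: circle \<Rightarrow> real. continuous_on UNIV \<phi> \<Longrightarrow> integrable \<nu> \<phi>"
    and dual: "\<And>\<phi>. continuous_on UNIV \<phi> \<Longrightarrow> (\<integral>x. L \<phi> x \<partial>\<nu>) = \<kappa> * (\<integral>x. \<phi> x \<partial>\<nu>)"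
    and \<kappa>: "0 < \<kappa>" and h: "continuous_on UNIV h" "\<And>x. 0 < h x" "L h = (\<lambda>x. \<kappa> * h x)"
    and lim: "\<And>\<phi> x. continuous_on UNIV \<phi> \<Longrightarrow>
      (\<lambda>n. (L ^^ n) \<phi> x / \<kappa> ^ n) \<longlonglongrightarrow> h x * (\<integral>y. \<phi> y \<partial>\<nu>)"
  shows "simple_eigenvalue L \<kappa>"
proof -
  have scale: "L (\<lambda>x. a * \<phi> x) = (\<lambda>x. a * L \<phi> x)" for a \<phi>
    using lin[of a \<phi> 0 \<phi>] by simp
  define \<Delta> where "\<Delta> g = (\<lambda>x. L g x - \<kappa> * g x)" for g :: "circle \<Rightarrow> real"
  have \<Delta>_cont: "continuous_on UNIV (\<Delta> g)" if "continuous_on UNIV g" for g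
    unfolding \<Delta>_def by (intro continuous_intros cont that)
  have eig: "\<phi> = (\<lambda>x. (\<integral>y. \<phi> y \<partial>\<nu>) * h x)" if \<phi>: "continuous_on UNIV \<phi>" "\<Delta> \<phi> = (\<lambda>_. 0)" for \<phi>
  proof
    fix x
    have L\<phi>: "L \<phi> = (\<lambda>x. \<kappa> * \<phi> x)" using \<phi>(2) by (auto simp: \<Delta>_def fun_eq_iff)
    have "(L ^^ n) \<phi> = (\<lambda>x. \<kappa> ^ n * \<phi> x)" for n
      by (induction n) (simp_all add: scale L\<phi> mult.assoc mult.left_commute)
    then have "(\<lambda>n. (L ^^ n) \<phi> x / \<kappa> ^ n) = (\<lambda>n. \<phi> x)" using \<kappa> by simp
    then show "\<phi> x = (\<integral>y. \<phi> y \<partial>\<nu>) * h x"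
      using lim[OF \<phi>(1), of x] by (simp add: LIMSEQ_const_iff mult.commute)
  qed
  have no_jordan: "\<Delta> \<psi> = (\<lambda>_. 0)" if "continuous_on UNIV \<psi>" "(\<Delta> ^^ n) \<psi> = (\<lambda>_. 0)" for \<psi> n
    using that
  proof (induction n arbitrary: \<psi>)
    case 0
    then show ?case using scale[of 0 "\<lambda>_. 0"] by (simp add: \<Delta>_def)
  next
    case (Suc n)
    have "(\<Delta> ^^ n) (\<Delta> \<psi>) = (\<lambda>_. 0)"
      using Suc.prems(2) by (simp only: funpow_Suc_right o_apply)
    then have "\<Delta> (\<Delta> \<psi>) = (\<lambda>_. 0)" by (rule Suc.IH[OF \<Delta>_cont[OF Suc.prems(1)]])
    then have "\<Delta> \<psi> = (\<lambda>x. (\<integral>y. \<Delta> \<psi> y \<partial>\<nu>) * h x)" by (rule eig[OF \<Delta>_cont[OF Suc.prems(1)]])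
    moreover have "(\<integral>y. \<Delta> \<psi> y \<partial>\<nu>) = 0"
      using Suc.prems(1) unfolding \<Delta>_def
      by (subst Bochner_Integration.integral_diff) (auto intro!: integrable cont simp: dual)
    ultimately show ?case by simp
  qed
  have "{\<psi>. continuous_on UNIV \<psi> \<and> (\<exists>n. (\<Delta> ^^ n) \<psi> = (\<lambda>_. 0))} = range (\<lambda>a x. a * h x)"
  proof (intro equalityI subsetI)
    fix \<psi> assume "\<psi> \<in> {\<psi>. continuous_on UNIV \<psi> \<and> (\<exists>n. (\<Delta> ^^ n) \<psi> = (\<lambda>_. 0))}"
    then show "\<psi> \<in> range (\<lambda>a x. a * h x)" using eig no_jordan by blast
  next
    fix \<psi> assume "\<psi> \<in> range (\<lambda>a x. a * h x)"
    then obtain a where a: "\<psi> = (\<lambda>x. a * h x)" by blast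
    have "(\<Delta> ^^ 1) \<psi> = (\<lambda>_. 0)" by (simp add: a \<Delta>_def scale h(3) mult_ac)
    moreover have "continuous_on UNIV \<psi>" unfolding a by (intro continuous_intros h(1))
    ultimately show "\<psi> \<in> {\<psi>. continuous_on UNIV \<psi> \<and> (\<exists>n. (\<Delta> ^^ n) \<psi> = (\<lambda>_. 0))}" by blast
  qed
  moreover have "eigenvalue L \<kappa>"
    unfolding eigenvalue_def using h(1,3) h(2)[of "Circle 0"]
    by (intro exI[of _ h]) (auto simp: fun_eq_iff intro!: exI[of _ "Circle 0"])
  moreover have "\<Delta> = (\<lambda>g x. L g x - \<kappa> * g x)" by (auto simp: \<Delta>_def fun_eq_iff)
  ultimately show ?thesis unfolding simple_eigenvalue_def by blast
qed

lemma Re_transfer_op: "Re (transfer_op T f \<phi> x) = transfer_op T f (\<lambda>y. Re (\<phi> y)) x"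
  by (simp add: transfer_op_def)

lemma Im_transfer_op: "Im (transfer_op T f \<phi> x) = transfer_op T f (\<lambda>y. Im (\<phi> y)) x"
  by (simp add: transfer_op_def)

lemma Re_transfer_op_iterate:
  "Re ((transfer_op T f ^^ n) \<phi> x) = (transfer_op T f ^^ n) (\<lambda>y. Re (\<phi> y)) x"
  by (induction n arbitrary: x) (simp_all add: Re_transfer_op)

lemma Im_transfer_op_iterate:
  "Im ((transfer_op T f ^^ n) \<phi> x) = (transfer_op T f ^^ n) (\<lambda>y. Im (\<phi> y)) x"
  by (induction n arbitrary: x) (simp_all add: Im_transfer_op)

text \<open>Evaluating the iterates of an eigenfunction where it does not vanish shows that \<open>(c / \<kappa>)\<^sup>n\<close>
  converges. As the modulus of \<open>c / \<kappa>\<close> is at least 1, the limit is not 0, and a geometric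
  sequence with nonzero limit is constant.\<close>

lemma eigenvalue_eq_of_convergence:
  fixes T :: "circle \<Rightarrow> circle" and l :: "(circle \<Rightarrow> real) \<Rightarrow> circle \<Rightarrow> real"
  assumes \<kappa>: "0 < \<kappa>"
    and lim: "\<And>\<phi> x. continuous_on UNIV \<phi> \<Longrightarrow>
      (\<lambda>n. (transfer_op T f ^^ n) \<phi> x / \<kappa> ^ n) \<longlonglongrightarrow> l \<phi> x"
    and eig: "eigenvalue (transfer_op T f) c" and c: "cmod c \<ge> \<kappa>"
  shows "c = of_real \<kappa>"
proof -
  let ?L = "transfer_op T f :: (circle \<Rightarrow> complex) \<Rightarrow> circle \<Rightarrow> complex"
  obtain \<phi> where \<phi>: "continuous_on UNIV \<phi>" "\<phi> \<noteq> (\<lambda>_. 0)" "?L \<phi> = (\<lambda>x. c * \<phi> x)"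
    using eig unfolding eigenvalue_def by blast
  then obtain x where x: "\<phi> x \<noteq> 0" by auto
  have scale: "?L (\<lambda>x. a * \<psi> x) = (\<lambda>x. a * ?L \<psi> x)" for a \<psi>
    by (auto simp: transfer_op_def sum_distrib_left)
  have Ln: "(?L ^^ n) \<phi> = (\<lambda>x. c ^ n * \<phi> x)" for n
    by (induction n) (simp_all add: scale \<phi>(3) mult.assoc mult.left_commute)
  define z where "z = c / of_real \<kappa>"
  have z: "1 \<le> norm z" using c \<kappa> by (simp add: z_def norm_divide)
  have eq: "(?L ^^ n) \<phi> x / of_real (\<kappa> ^ n) = z ^ n * \<phi> x" for n
    by (simp add: Ln z_def power_divide)
  have "(\<lambda>n. z ^ n * \<phi> x) \<longlonglongrightarrow> Complex (l (\<lambda>y. Re (\<phi> y)) x) (l (\<lambda>y. Im (\<phi> y)) x)"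
  proof -
    have "(\<lambda>n. Re ((?L ^^ n) \<phi> x / of_real (\<kappa> ^ n))) \<longlonglongrightarrow> l (\<lambda>y. Re (\<phi> y)) x"
      "(\<lambda>n. Im ((?L ^^ n) \<phi> x / of_real (\<kappa> ^ n))) \<longlonglongrightarrow> l (\<lambda>y. Im (\<phi> y)) x"
      unfolding Re_divide_of_real Im_divide_of_real Re_transfer_op_iterate Im_transfer_op_iterate
      by (intro lim continuous_intros \<phi>(1))+
    then show ?thesis unfolding tendsto_complex_iff eq by simp
  qed
  from tendsto_divide[OF this tendsto_const x] x
  obtain w where w: "(\<lambda>n. z ^ n) \<longlonglongrightarrow> w" by auto
  have "(\<lambda>n. z * z ^ n) \<longlonglongrightarrow> z * w" by (intro tendsto_intros w)
  moreover have "(\<lambda>n. z * z ^ n) \<longlonglongrightarrow> w" using LIMSEQ_Suc[OF w] by simp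
  ultimately have "z * w = w" using LIMSEQ_unique by blast
  moreover have "w \<noteq> 0"
  proof -
    have "1 \<le> norm w"
      using z by (intro LIMSEQ_le_const[OF tendsto_norm[OF w]]) (auto simp: norm_power one_le_power)
    then show ?thesis by auto
  qed
  ultimately have "z = 1" by simp
  then show ?thesis using \<kappa> by (simp add: z_def)
qed

lemma scale_measure_eq_density: "scale_measure c M = density M (\<lambda>_. c)"
  by (rule measure_eqI) (auto simp: emeasure_density nn_integral_cmult_indicator)

theorem theorem2:
  fixes T :: "circle \<Rightarrow> circle" and \<omega> \<Omega> :: "real \<Rightarrow> real" and f :: "circle \<Rightarrow> real"
  assumes "T \<in> family_F"
    and "\<omega> \<in> moduli" and "\<Omega> \<in> moduli"
    and "compatible T \<omega> \<Omega>"
    and "f \<in> C_mod \<omega>"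
  shows "\<exists>(\<nu> :: circle measure) (chi :: real).
    prob_space \<nu> \<and> sets \<nu> = sets borel \<and> chi > 0 \<and>
    transfer_dual T f \<nu> (scale_measure (ennreal chi) \<nu>) \<and>
    simple_eigenvalue (transfer_op T f) chi \<and>
    (\<exists>h :: circle \<Rightarrow> real. h \<in> C_mod \<Omega> \<and> (\<forall>x. h x > 0) \<and>
       transfer_op T f h = (\<lambda>x. chi * h x) \<and>
       (\<integral>x. h x \<partial>\<nu>) = 1 \<and>
       (\<forall>\<phi> :: circle \<Rightarrow> real. continuous_on UNIV \<phi> \<longrightarrow>
          uniform_limit UNIV (\<lambda>n x. (transfer_op T f ^^ n) \<phi> x / chi ^ n)
            (\<lambda>x. h x * (\<integral>y. \<phi> y \<partial>\<nu>)) sequentially)) \<and>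
    \<not> (\<exists>c :: complex. eigenvalue (transfer_op T f) c \<and> c \<noteq> of_real chi \<and> cmod c \<ge> chi)"
proof -
  have surj: "surj T" by (rule family_F_surj[OF assms(1)])
  obtain \<rho> C where \<rho>: "\<rho> > 0" and C: "C > 0" and
    branch: "\<And>p q. dist p q < \<rho> \<Longrightarrow> \<exists>\<pi>. bij_betw \<pi> (T -` {p}) (T -` {q}) \<and>
       (\<forall>z\<in>T -` {p}. dist z (\<pi> z) \<le> dist p q \<and>
          \<Omega> (dist z (\<pi> z)) + C * \<omega> (dist z (\<pi> z)) \<le> \<Omega> (dist p q))"
    by (rule compatible_branches[OF surj assms(4)]) blast
  obtain Cf where Cf: "Cf > 0" "\<And>x y. \<bar>f x - f y\<bar> \<le> Cf * \<omega> (dist x y)"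
    using assms(5) unfolding C_mod_def by blast
  have \<Omega>: "mono_on {0..} \<Omega>" "\<Omega> 0 = 0" "continuous_on {0..} \<Omega>"
    and \<omega>: "mono_on {0..} \<omega>"
    using assms(2,3) by (auto simp: moduli_def)
  \<comment> \<open>With this factor, the gain \<open>K C \<omega>\<close> from compatibility equals the possible variation \<open>Cf \<omega>\<close>
     of the potential.\<close>
  define K where "K = Cf / C"
  have K: "0 < K" using Cf(1) C by (simp add: K_def)
  define \<theta> where "\<theta> t = K * \<Omega> t" for t
  define B where "B = \<bar>f (Circle 0)\<bar> + Cf * \<omega> 1"
  interpret branching_operator T f \<theta> \<rho> B
  proof
    show "finite (T -` {x})" for x by (rule finite_fibre[OF assms(1)])
    show "surj T" by (rule surj)
    show "0 < \<rho>" by (rule \<rho>)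
    show "mono_on {0..} \<theta>"
      unfolding \<theta>_def using K by (intro mono_onI mult_left_mono mono_onD[OF \<Omega>(1)]) auto
    show "\<theta> 0 = 0" by (simp add: \<theta>_def \<Omega>(2))
    show "\<exists>\<delta>>0. \<theta> \<delta> < \<epsilon>" if "0 < \<epsilon>" for \<epsilon>
    proof -
      have "0 < \<epsilon> / K" using that K by simp
      then obtain d where d: "d > 0" "\<And>x. 0 \<le> x \<Longrightarrow> \<bar>x\<bar> < d \<Longrightarrow> \<bar>\<Omega> x\<bar> < \<epsilon> / K"
        using \<Omega>(2,3) unfolding continuous_on_iff dist_real_def
        by (metis atLeast_iff diff_zero order_refl)
      have "\<Omega> (d / 2) < \<epsilon> / K" using d(1) d(2)[of "d / 2"] by auto
      then have "\<theta> (d / 2) < \<epsilon>" using K by (simp add: \<theta>_def field_simps)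
      then show ?thesis using d(1) half_gt_zero by blast
    qed
    show "\<exists>\<pi>. bij_betw \<pi> (T -` {p}) (T -` {q}) \<and>
       (\<forall>z\<in>T -` {p}. dist z (\<pi> z) \<le> dist p q \<and> f z + \<theta> (dist z (\<pi> z)) \<le> f (\<pi> z) + \<theta> (dist p q))"
      if "dist p q < \<rho>" for p q
    proof -
      have "f z + \<theta> d \<le> f w + \<theta> e" if "\<Omega> d + C * \<omega> d \<le> \<Omega> e" "d = dist z w" for z w d e
      proof -
        have f_le: "f z - f w \<le> Cf * \<omega> d"
          using Cf(2)[of z w] that(2) by (simp add: abs_le_iff)
        have "K * (\<Omega> d + C * \<omega> d) \<le> K * \<Omega> e" using that(1) K by (intro mult_left_mono) auto
        moreover have "K * (C * \<omega> d) = Cf * \<omega> d" using C by (simp add: K_def field_simps)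
        ultimately show ?thesis
          using f_le unfolding \<theta>_def distrib_left by linarith
      qed
      then show ?thesis using branch[OF that] by blast
    qed
    show "\<bar>f x\<bar> \<le> B" for x
    proof -
      have "\<omega> (dist x (Circle 0)) \<le> \<omega> 1" using dist_le_one by (intro mono_onD[OF \<omega>]) auto
      then have "Cf * \<omega> (dist x (Circle 0)) \<le> Cf * \<omega> 1" using Cf(1) by simp
      then show ?thesis using Cf(2)[of x "Circle 0"] unfolding B_def by linarith
    qed
    show "\<exists>N. \<forall>x z. \<exists>y. dist y z < \<delta> \<and> (T ^^ N) y = x" if "0 < \<delta>" for \<delta>
      by (rule family_F_mixing[OF assms(1) that])
  qed
  obtain \<nu> :: "circle measure" where \<nu>: "prob_space \<nu>" "sets \<nu> = sets borel"
    "\<And>\<phi>. continuous_on UNIV \<phi> \<Longrightarrow>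
       uniform_limit UNIV (\<lambda>n. ratio n \<phi>) (\<lambda>_. \<integral>y. \<phi> y \<partial>\<nu>) sequentially"
    by (rule ratio_limit_measure) blast
  interpret ratio_measure T f \<theta> \<rho> B \<nu>
    by (intro ratio_measure.intro ratio_measure_axioms.intro branching_operator_axioms \<nu>)
  obtain h where h: "log_cont \<rho> 0 h" "L h = (\<lambda>x. chi * h x)" "(\<integral>x. h x \<partial>\<nu>) = 1"
    and conv: "\<And>\<phi>. continuous_on UNIV \<phi> \<Longrightarrow>
      uniform_limit UNIV (\<lambda>n x. (L ^^ n) \<phi> x / chi ^ n) (\<lambda>x. h x * (\<integral>y. \<phi> y \<partial>\<nu>)) sequentially"
    by (rule eigenfunction) blast
  have h_pos: "0 < h x" for x by (rule log_contD(1)[OF h(1)])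
  have L_cont: "continuous_on UNIV (L \<phi>)" if "continuous_on UNIV \<phi>" for \<phi>
    using Ln_continuous[OF that, of 1] by simp
  have h_cont: "continuous_on UNIV h"
  proof (rule log_cont_imp_continuous)
    fix \<epsilon> :: real assume "0 < \<epsilon>"
    have "h p \<le> h q * exp (\<theta> (dist p q) + \<epsilon>)" if "dist p q < \<rho>" for p q
    proof -
      have "h p \<le> h q * exp (\<theta> (dist p q) + 0)" by (rule log_contD(2)[OF h(1) that])
      also have "\<dots> \<le> h q * exp (\<theta> (dist p q) + \<epsilon>)"
        using h_pos[of q] \<open>0 < \<epsilon>\<close> by (intro mult_left_mono) auto
      finally show ?thesis .
    qed
    then show "\<exists>\<delta>>0. log_cont \<delta> \<epsilon> h" using \<rho> h_pos unfolding log_cont_def by blast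
  qed
  have h_mod: "h \<in> C_mod \<Omega>"
  proof -
    obtain A where A: "0 < A" "\<And>x y. \<bar>h x - h y\<bar> \<le> A * \<theta> (dist x y)"
      by (rule log_cont_imp_modulus[OF h(1)]) blast
    then show ?thesis
      unfolding C_mod_def \<theta>_def using K by (auto simp: mult.assoc intro!: exI[of _ "A * K"])
  qed
  have lim: "(\<lambda>n. (L ^^ n) \<phi> x / chi ^ n) \<longlonglongrightarrow> h x * (\<integral>y. \<phi> y \<partial>\<nu>)" if "continuous_on UNIV \<phi>" for \<phi> x
    by (rule tendsto_uniform_limitI[OF conv[OF that] UNIV_I])
  have "simple_eigenvalue L chi"
    by (rule simple_eigenvalue_of_convergence[where \<nu> = \<nu> and h = h])
      (use L_lin L_cont integrable_continuous integral_L chi_pos h_cont h_pos h(2) lim in auto)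
  moreover have "transfer_dual T f \<nu> (scale_measure (ennreal chi) \<nu>)"
  proof -
    interpret \<nu>: prob_space \<nu> by (rule \<nu>(1))
    have "finite_measure (scale_measure (ennreal chi) \<nu>)"
      by (rule finite_measureI) (simp add: space_scale_measure \<nu>.emeasure_space_1)
    moreover have "(\<integral>x. \<phi> x \<partial>scale_measure (ennreal chi) \<nu>) = (\<integral>x. L \<phi> x \<partial>\<nu>)"
      if \<phi>: "continuous_on UNIV \<phi>" for \<phi>
    proof -
      have "\<phi> \<in> borel_measurable \<nu>"
        using integrable_continuous[OF \<phi>] by auto
      have "(\<integral>x. \<phi> x \<partial>scale_measure (ennreal chi) \<nu>) = chi * (\<integral>x. \<phi> x \<partial>\<nu>)"
        using \<open>\<phi> \<in> borel_measurable \<nu>\<close> chi_pos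
        unfolding scale_measure_eq_density by (subst integral_density) auto
      then show ?thesis by (simp add: integral_L[OF \<phi>])
    qed
    ultimately show ?thesis
      unfolding transfer_dual_def using \<nu>(2) \<nu>.finite_measure_axioms by simp
  qed
  moreover have "c = of_real chi" if "eigenvalue (transfer_op T f) c" "cmod c \<ge> chi" for c
    by (rule eigenvalue_eq_of_convergence[OF chi_pos lim that])
  ultimately show ?thesis
    using \<nu>(1,2) chi_pos h_mod h_pos h(2,3) conv by blast
qed

end
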